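(* Let $p$ be a permutation containing exactly one $321$-pattern, and let $w$ be a $p$-friendly permutation in which every $321$-pattern is contained in exactly $k$ $p$-patterns. Let $X$ be the commutation class of the highest rank in $P(p)$, and let $c$ denote the sum of indices of the commutation class of the lowest rank in $P(w)$. Then the number of $X$-subnetworks in a reduced decomposition $(i_1,i_2,\ldots,i_l)$ of $w$ is equal to $$k\left(\Big(\sum_{j=1}^{l}i_j\Big)-c\right).$$
   Context: A reduced decomposition of $w\in S_n$ is a sequence $(i_1,\ldots,i_l)$ with entries in $\{1,\ldots,n-1\}$, where $l$ is the number of inversions of $w$, such that $w=s_{i_1}s_{i_2}\cdots s_{i_l}$, where $s_i$ is the adjacent transposition swapping the entries in positions $i$ and $i+1$ (so $w$ is obtained from $12\cdots n$ by successively swapping the entries in positions $i_k,i_k+1$). Its sum of indices is $i_1+\cdots+i_l$. Two reduced decompositions of $w$ are in the same commutation class if one can be obtained from the other by a sequence of moves replacing two consecutive entries $i,j$ with $|i-j|\ge2$ by $j,i$; the sum of indices is constant on a commutation class. A long braid move replaces three consecutive entries $i,i+1,i$ by $i+1,i,i+1$ or vice versa; it changes the sum of indices by exactly $1$, and is called a downward move if it decreases it. $P(w)$ is the partial order on the set of commutation classes of reduced decompositions of $w$ whose cover relation is: $A$ covers $B$ if there are $\rho_a\in A$ and $\rho_b\in B$ such that $\rho_b$ is obtained from $\rho_a$ by a downward move. $P(w)$ is ranked by the sum of indices. Patterns: for $p\in S_m$ and $w\in S_n$, a $p$-pattern of $w$ is a choice of $i_1<\cdots<i_m$ such that for all $h,j$: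 $w(i_h)<w(i_j)$ if and only if $p(h)<p(j)$. A permutation $w$ is $p$-friendly if there is a constant $k$ such that any $321$-pattern of $w$ is contained in exactly $k$ $p$-patterns of $w$. Subnetworks: let $\rho$ be a reduced decomposition of $w\in S_n$ and let $A\subseteq\{1,\ldots,n\}$ be a set of $m$ distinct integers. Follow the sequence of words from $12\cdots n$ to $w$ determined by $\rho$, keeping track only of the relative positions of the elements of $A$. Whenever a step of $\rho$ swaps two elements of $A$, these two occupy positions $j$ and $j+1$ among the elements of $A$; record $j$. The resulting sequence is the reduced decomposition of $A$ induced by $\rho$ (a reduced decomposition of the permutation in $S_m$ with the same relative order as the elements of $A$ in $w$). For a set $X$ of reduced decompositions of an element of $S_m$, an $X$-subnetwork of $\rho$ is a set $A$ of $m$ distinct integers of $\{1,\ldots,n\}$ whose reduced decomposition induced by $\rho$ belongs to $X$. *)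

theory Defs
  imports "HOL-Combinatorics.Permutations" "HOL-Algebra.Order"
begin

text \<open>
  A permutation in \<open>S_n\<close> is a function \<open>w\<close> with \<open>w permutes {1..n}\<close>; its one-line word is
  \<open>w 1, \<dots>, w n\<close>.  Composing on the right with \<open>transpose i (Suc i)\<close> swaps the entries in
  positions \<open>i\<close> and \<open>i + 1\<close> of that word.
\<close>

subsection \<open>Reduced decompositions\<close>

definition inversions :: "nat \<Rightarrow> (nat \<Rightarrow> nat) \<Rightarrow> (nat \<times> nat) set" where
  "inversions n w = {(i, j). 1 \<le> i \<and> i < j \<and> j \<le> n \<and> w j < w i}"

fun word_perm :: "nat list \<Rightarrow> nat \<Rightarrow> nat" where
  "word_perm [] = id"
| "word_perm (i # \<rho>) = transpose i (Suc i) \<circ> word_perm \<rho>"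

definition reduced_decomps :: "nat \<Rightarrow> (nat \<Rightarrow> nat) \<Rightarrow> nat list set" where
  "reduced_decomps n w =
     {\<rho>. set \<rho> \<subseteq> {1..<n} \<and> length \<rho> = card (inversions n w) \<and> word_perm \<rho> = w}"

definition commutation_move :: "nat list \<Rightarrow> nat list \<Rightarrow> bool" where
  "commutation_move \<rho> \<sigma> \<longleftrightarrow>
     (\<exists>us vs i j. 2 \<le> \<bar>int i - int j\<bar> \<and> \<rho> = us @ [i, j] @ vs \<and> \<sigma> = us @ [j, i] @ vs)"

definition commutation_equiv :: "nat \<Rightarrow> (nat \<Rightarrow> nat) \<Rightarrow> nat list rel" where
  "commutation_equiv n w =
     {(\<rho>, \<sigma>). \<rho> \<in> reduced_decomps n w \<and> \<sigma> \<in> reduced_decomps n w \<and> commutation_move\<^sup>*\<^sup>* \<rho> \<sigma>}"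

definition commutation_classes :: "nat \<Rightarrow> (nat \<Rightarrow> nat) \<Rightarrow> nat list set set" where
  "commutation_classes n w = reduced_decomps n w // commutation_equiv n w"

definition long_braid_move :: "nat list \<Rightarrow> nat list \<Rightarrow> bool" where
  "long_braid_move \<rho> \<sigma> \<longleftrightarrow>
     (\<exists>us vs i. (\<rho> = us @ [i, i + 1, i] @ vs \<and> \<sigma> = us @ [i + 1, i, i + 1] @ vs) \<or>
                (\<rho> = us @ [i + 1, i, i + 1] @ vs \<and> \<sigma> = us @ [i, i + 1, i] @ vs))"

definition downward_move :: "nat list \<Rightarrow> nat list \<Rightarrow> bool" where
  "downward_move \<rho> \<sigma> \<longleftrightarrow> long_braid_move \<rho> \<sigma> \<and> sum_list \<sigma> < sum_list \<rho>"


subsection \<open>The poset of commutation classes\<close>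

definition class_covers :: "nat \<Rightarrow> (nat \<Rightarrow> nat) \<Rightarrow> nat list set \<Rightarrow> nat list set \<Rightarrow> bool" where
  "class_covers n w A B \<longleftrightarrow>
     A \<in> commutation_classes n w \<and> B \<in> commutation_classes n w \<and>
     (\<exists>\<rho>\<^sub>a\<in>A. \<exists>\<rho>\<^sub>b\<in>B. downward_move \<rho>\<^sub>a \<rho>\<^sub>b)"

definition class_poset :: "nat \<Rightarrow> (nat \<Rightarrow> nat) \<Rightarrow> nat list set gorder" where
  "class_poset n w =
     \<lparr> carrier = commutation_classes n w,
       eq = (=),
       le = (\<lambda>B A. (class_covers n w)\<^sup>*\<^sup>* A B) \<rparr>"

text \<open>
  The rank of a class is the common sum of indices of its members; the choice of representative
  is irrelevant by \<open>class_rank_eq\<close> below.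
\<close>

definition class_rank :: "nat list set \<Rightarrow> nat" where
  "class_rank A = sum_list (SOME \<rho>. \<rho> \<in> A)"

lemma commutation_move_sym: "commutation_move \<rho> \<sigma> \<Longrightarrow> commutation_move \<sigma> \<rho>"
  unfolding commutation_move_def by (metis abs_minus_commute)

lemma equiv_commutation_equiv: "equiv (reduced_decomps n w) (commutation_equiv n w)"
proof (rule equivI)
  show "commutation_equiv n w \<subseteq> reduced_decomps n w \<times> reduced_decomps n w"
    by (auto simp: commutation_equiv_def)
  show "refl_on (reduced_decomps n w) (commutation_equiv n w)"
    by (rule refl_onI) (simp add: commutation_equiv_def)
  have "symp commutation_move\<^sup>*\<^sup>*"
    by (rule symp_rtranclp) (rule sympI, rule commutation_move_sym)
  then show "sym (commutation_equiv n w)"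
    unfolding commutation_equiv_def by (blast intro: symI dest: sympD)
  show "trans (commutation_equiv n w)"
    unfolding commutation_equiv_def by (blast intro: transI rtranclp_trans)
qed

lemma sum_list_commutation: "commutation_move\<^sup>*\<^sup>* \<rho> \<sigma> \<Longrightarrow> sum_list \<rho> = sum_list \<sigma>"
  by (induction rule: rtranclp_induct) (auto simp: commutation_move_def)

lemma class_rank_eq:
  assumes "A \<in> commutation_classes n w" and "\<rho> \<in> A"
  shows "class_rank A = sum_list \<rho>"
proof -
  have "(SOME \<rho>. \<rho> \<in> A) \<in> A"
    using assms(2) by (rule someI)
  then have "(SOME \<rho>. \<rho> \<in> A, \<rho>) \<in> commutation_equiv n w"
    using assms quotient_eq_iff[OF equiv_commutation_equiv, of A n w A]
    unfolding commutation_classes_def by blast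
  then have "commutation_move\<^sup>*\<^sup>* (SOME \<rho>. \<rho> \<in> A) \<rho>"
    by (simp add: commutation_equiv_def)
  then show ?thesis
    unfolding class_rank_def by (rule sum_list_commutation)
qed

lemma class_rank_covers:
  assumes "class_covers n w A B"
  shows "class_rank A = class_rank B + 1"
proof -
  obtain \<rho> \<sigma> where *: "\<rho> \<in> A" "\<sigma> \<in> B" "downward_move \<rho> \<sigma>"
    using assms unfolding class_covers_def by blast
  have "sum_list \<rho> = sum_list \<sigma> + 1"
    using *(3) by (auto simp: downward_move_def long_braid_move_def)
  moreover have "class_rank A = sum_list \<rho>" "class_rank B = sum_list \<sigma>"
    using assms *(1,2) unfolding class_covers_def by (blast intro: class_rank_eq)+
  ultimately show ?thesis
    by simp
qed

lemma partial_order_class_poset: "partial_order (class_poset n w)"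
proof -
  have rank: "class_rank B < class_rank A \<or> A = B" if "(class_covers n w)\<^sup>*\<^sup>* A B" for A B
    using that by (induction rule: rtranclp_induct) (auto dest: class_rank_covers)
  have antisym: "A = B"
    if "(class_covers n w)\<^sup>*\<^sup>* A B" and "(class_covers n w)\<^sup>*\<^sup>* B A" for A B
    using rank[OF that(1)] rank[OF that(2)] by (metis less_asym)
  show ?thesis
    by unfold_locales (simp_all add: class_poset_def antisym)
qed


subsection \<open>Patterns\<close>

text \<open>A pattern is represented by the set of the chosen positions \<open>i 1 < \<dots> < i m\<close>.\<close>

definition patterns :: "nat \<Rightarrow> (nat \<Rightarrow> nat) \<Rightarrow> nat \<Rightarrow> (nat \<Rightarrow> nat) \<Rightarrow> nat set set" where
  "patterns m p n w =
     {i ` {1..m} | i. i ` {1..m} \<subseteq> {1..n} \<and> strict_mono_on {1..m} i \<and>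
        (\<forall>h\<in>{1..m}. \<forall>j\<in>{1..m}. w (i h) < w (i j) \<longleftrightarrow> p h < p j)}"

definition perm321 :: "nat \<Rightarrow> nat" where
  "perm321 = transpose 1 3"

definition patterns321 :: "nat \<Rightarrow> (nat \<Rightarrow> nat) \<Rightarrow> nat set set" where
  "patterns321 n w = patterns 3 perm321 n w"

definition friendly_with :: "nat \<Rightarrow> (nat \<Rightarrow> nat) \<Rightarrow> nat \<Rightarrow> (nat \<Rightarrow> nat) \<Rightarrow> nat \<Rightarrow> bool" where
  "friendly_with m p n w k \<longleftrightarrow>
     (\<forall>T\<in>patterns321 n w. card {Q \<in> patterns m p n w. T \<subseteq> Q} = k)"

definition friendly :: "nat \<Rightarrow> (nat \<Rightarrow> nat) \<Rightarrow> nat \<Rightarrow> (nat \<Rightarrow> nat) \<Rightarrow> bool" where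
  "friendly m p n w \<longleftrightarrow> (\<exists>k. friendly_with m p n w k)"


subsection \<open>Subnetworks\<close>

text \<open>
  \<open>induced_from u A \<rho>\<close> follows \<open>\<rho>\<close> starting from the word \<open>u\<close>.  When the entries in positions \<open>i\<close>
  and \<open>i + 1\<close> both lie in \<open>A\<close>, the position of \<open>u i\<close> among the elements of \<open>A\<close> is the number of
  positions up to \<open>i\<close> whose entry is in \<open>A\<close>.
\<close>

fun induced_from :: "(nat \<Rightarrow> nat) \<Rightarrow> nat set \<Rightarrow> nat list \<Rightarrow> nat list" where
  "induced_from u A [] = []"
| "induced_from u A (i # \<rho>) =
     (if u i \<in> A \<and> u (Suc i) \<in> A then [card {q \<in> {1..i}. u q \<in> A}] else []) @
     induced_from (u \<circ> transpose i (Suc i)) A \<rho>"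

definition induced :: "nat set \<Rightarrow> nat list \<Rightarrow> nat list" where
  "induced A \<rho> = induced_from id A \<rho>"

definition subnetworks :: "nat \<Rightarrow> nat list set \<Rightarrow> nat \<Rightarrow> nat list \<Rightarrow> nat set set" where
  "subnetworks m X n \<rho> = {A. A \<subseteq> {1..n} \<and> card A = m \<and> induced A \<rho> \<in> X}"

end

theory Submission
  imports Defs "HOL-Library.Infinite_Set"
begin

text \<open>
  When entries \<open>x < y\<close> are swapped at positions \<open>i\<close> and \<open>i + 1\<close>, the index \<open>i\<close> counts the entries to
  their left.  Those below \<open>y\<close> contribute the decrease of a potential depending only on the word;
  each \<open>z > y\<close> contributes a triple \<open>z y x\<close> whose three inversions are created in the order
  \<open>2, 1, 2\<close>.  Hence the sum of indices is a constant depending on \<open>w\<close> plus the number of such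
  triples.  Suitable choices of the last descent yield decompositions in which no, respectively
  every, 321-pattern of \<open>w\<close> is such a triple, so \<open>c\<close> is that constant.  Two decompositions with
  the same triples are commutation equivalent, so \<open>X\<close> consists of the decompositions of \<open>p\<close> with
  a triple.  The triples of an induced decomposition are those of \<open>\<rho>\<close> contained in \<open>A\<close>, and
  it remains to count the pairs of a triple and a \<open>p\<close>-pattern containing it.
\<close>

subsection \<open>Ascending words and the triples they create\<close>

abbreviation adj :: "nat \<Rightarrow> nat \<Rightarrow> nat" where
  "adj i \<equiv> transpose i (Suc i)"

text \<open>Reducedness stated letter by letter: every swap creates a new inversion. Unlike the
  length condition, this passes to suffixes, which start from an arbitrary word
  \<open>u\<close>.\<close>

fun ascending :: "nat \<Rightarrow> (nat \<Rightarrow> nat) \<Rightarrow> nat list \<Rightarrow> bool" where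
  "ascending n u [] = True"
| "ascending n u (i # \<rho>) \<longleftrightarrow> i \<in> {1..<n} \<and> u i < u (Suc i) \<and> ascending n (u \<circ> adj i) \<rho>"

lemma ascending_append:
  "ascending n u (\<rho> @ \<sigma>) \<longleftrightarrow> ascending n u \<rho> \<and> ascending n (u \<circ> word_perm \<rho>) \<sigma>"
  by (induction \<rho> arbitrary: u) (auto simp: comp_assoc)

lemma comp_word_perm_Cons: "u \<circ> word_perm (i # \<rho>) = u \<circ> adj i \<circ> word_perm \<rho>"
  by (simp only: word_perm.simps comp_assoc)

lemma word_perm_append: "word_perm (\<rho> @ \<sigma>) = word_perm \<rho> \<circ> word_perm \<sigma>"
  by (induction \<rho>) (auto simp: comp_assoc)

lemma bij_word_perm: "bij (word_perm \<rho>)"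
  by (induction \<rho>) (simp_all only: word_perm.simps bij_id bij_comp bij_transpose)

lemma bij_comp_adj: "bij u \<Longrightarrow> bij (u \<circ> adj i)"
  by (simp add: bij_comp)

lemma ascending_set: "ascending n u \<rho> \<Longrightarrow> set \<rho> \<subseteq> {1..<n}"
  by (induction n u \<rho> rule: ascending.induct) auto

section \<open>Inversions and reduced decompositions\<close>

lemma finite_inversions: "finite (inversions n u)"
  by (rule finite_subset[of _ "{1..n} \<times> {1..n}"]) (auto simp: inversions_def)

lemma adj_less: "a < b \<Longrightarrow> \<not> (a = i \<and> b = Suc i) \<Longrightarrow> adj i a < adj i b"
  by (auto simp: transpose_def)

lemma adj_range: "i \<in> {1..<n} \<Longrightarrow> a \<in> {1..n} \<Longrightarrow> adj i a \<in> {1..n}"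
  by (auto simp: transpose_def)

text \<open>\<open>adj i\<close> preserves the order of every pair of positions other than
  \<open>i\<close>, \<open>Suc i\<close>, so the old inversions are carried along and only that pair
  is added.\<close>

lemma inversions_adj:
  assumes "i \<in> {1..<n}" "u i < u (Suc i)"
  shows "inversions n (u \<circ> adj i) = insert (i, Suc i) (map_prod (adj i) (adj i) ` inversions n u)"
    (is "?L = ?R")
proof -
  have "(a, b) \<in> ?L \<longleftrightarrow> (a, b) \<in> ?R" for a b
  proof -
    have img: "(a, b) \<in> map_prod (adj i) (adj i) ` inversions n u \<longleftrightarrow> (adj i a, adj i b) \<in> inversions n u"
    proof
      assume "(adj i a, adj i b) \<in> inversions n u"
      from imageI[OF this, of "map_prod (adj i) (adj i)"]
      show "(a, b) \<in> map_prod (adj i) (adj i) ` inversions n u" by simp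
    qed auto
    show ?thesis
    proof (cases "a = i \<and> b = Suc i")
      case True
      then show ?thesis using assms by (auto simp: inversions_def)
    next
      case False
      have "(a, b) \<in> ?L \<longleftrightarrow> (adj i a, adj i b) \<in> inversions n u"
      proof
        assume *: "(a, b) \<in> ?L"
        then have "a \<in> {1..n}" "b \<in> {1..n}" "a < b" by (auto simp: inversions_def)
        with adj_range[OF assms(1)] adj_less[OF _ False] have
          "adj i a \<in> {1..n}" "adj i b \<in> {1..n}" "adj i a < adj i b" by blast+
        with * show "(adj i a, adj i b) \<in> inversions n u" by (auto simp: inversions_def)
      next
        assume *: "(adj i a, adj i b) \<in> inversions n u"
        then have r: "adj i a \<in> {1..n}" "adj i b \<in> {1..n}" "adj i a < adj i b" "u (adj i b) < u (adj i a)"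
          by (auto simp: inversions_def)
        then have "\<not> (adj i a = i \<and> adj i b = Suc i)" using assms(2) by (metis order.asym)
        with adj_less[OF r(3), of i] have "a < b" by simp
        with adj_range[OF assms(1) r(1)] adj_range[OF assms(1) r(2)] r(4)
        show "(a, b) \<in> ?L" by (auto simp: inversions_def)
      qed
      with False img show ?thesis by auto
    qed
  qed
  then show ?thesis by (intro Set.set_eqI) (metis surj_pair)
qed

lemma card_inversions_adj:
  assumes "i \<in> {1..<n}" "u i < u (Suc i)"
  shows "card (inversions n (u \<circ> adj i)) = Suc (card (inversions n u))"
proof -
  have "(i, Suc i) \<notin> map_prod (adj i) (adj i) ` inversions n u"
    by (auto simp: inversions_def transpose_def split: if_splits)
  moreover have "inj_on (map_prod (adj i) (adj i)) (inversions n u)"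
    by (auto intro!: inj_onI dest: injD[OF inj_transpose])
  ultimately show ?thesis
    by (simp add: inversions_adj[OF assms] finite_inversions card_image)
qed

lemma card_inversions_adj_descent:
  assumes "i \<in> {1..<n}" "u (Suc i) < u i"
  shows "card (inversions n u) = Suc (card (inversions n (u \<circ> adj i)))"
  using card_inversions_adj[OF assms(1), of "u \<circ> adj i"] assms(2) by (simp add: comp_assoc)

text \<open>Each letter changes the number of inversions by one, up or down, so the bound is
  attained exactly when no letter goes down.\<close>

lemma card_inversions_le:
  assumes "inj u" "set \<rho> \<subseteq> {1..<n}"
  shows "card (inversions n (u \<circ> word_perm \<rho>)) \<le> card (inversions n u) + length \<rho> \<and>
    (card (inversions n (u \<circ> word_perm \<rho>)) = card (inversions n u) + length \<rho>
      \<longleftrightarrow> ascending n u \<rho>)"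
  using assms
proof (induction \<rho> arbitrary: u)
  case (Cons i \<rho>)
  have u': "inj (u \<circ> adj i)" using Cons.prems by (simp add: inj_compose)
  have i: "i \<in> {1..<n}" "set \<rho> \<subseteq> {1..<n}" using Cons.prems by auto
  note IH = Cons.IH[OF u' i(2)]
  have "u i \<noteq> u (Suc i)" using Cons.prems by (auto dest: injD)
  then consider "u i < u (Suc i)" | "u (Suc i) < u i" by linarith
  then show ?case
  proof cases
    case 1
    then show ?thesis using IH i(1) unfolding comp_word_perm_Cons ascending.simps list.size
        card_inversions_adj[OF i(1) 1] by linarith
  next
    case 2
    then show ?thesis using IH unfolding comp_word_perm_Cons ascending.simps list.size
        card_inversions_adj_descent[OF i(1) 2] by linarith
  qed
qed auto

text \<open>The identity has no inversions, so the length condition is the equality case of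
  \<open>card_inversions_le\<close>.\<close>

lemma mem_reduced_decomps:
  "\<rho> \<in> reduced_decomps n w \<longleftrightarrow> ascending n id \<rho> \<and> word_perm \<rho> = w"
proof -
  have "inversions n id = {}" by (auto simp: inversions_def)
  then show ?thesis
    using card_inversions_le[of id \<rho> n] ascending_set[of n id \<rho>]
    by (auto simp: reduced_decomps_def)
qed

text \<open>
  A triple \<open>(x, y, z)\<close> of values is collected when \<open>x < y\<close> are swapped to the right of \<open>z > y\<close>, so
  that \<open>z y x\<close> was created in the order \<open>2, 1, 2\<close>.
\<close>

definition step_triples :: "(nat \<Rightarrow> nat) \<Rightarrow> nat \<Rightarrow> (nat \<times> nat \<times> nat) set" where
  "step_triples u i = {(u i, u (Suc i), z) | z. u (Suc i) < z \<and> inv u z < i}"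

fun triples :: "(nat \<Rightarrow> nat) \<Rightarrow> nat list \<Rightarrow> (nat \<times> nat \<times> nat) set" where
  "triples u [] = {}"
| "triples u (i # \<rho>) = step_triples u i \<union> triples (u \<circ> adj i) \<rho>"

text \<open>Values are recorded rather than positions because they stay the same along a
  decomposition. The range of the values is left open; for permutations of \<open>{1..n}\<close> it
  is derived in \<open>bij_betw_positions\<close>.\<close>

definition triples321 :: "(nat \<Rightarrow> nat) \<Rightarrow> (nat \<times> nat \<times> nat) set" where
  "triples321 u = {(x, y, z). x < y \<and> y < z \<and> inv u z < inv u y \<and> inv u y < inv u x}"

section \<open>Collected triples along a word\<close>

lemma triples_append: "triples u (\<rho> @ \<sigma>) = triples u \<rho> \<union> triples (u \<circ> word_perm \<rho>) \<sigma>"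
  by (induction \<rho> arbitrary: u) (auto simp: comp_assoc)

lemma inv_comp_adj: "bij u \<Longrightarrow> inv (u \<circ> adj i) x = adj i (inv u x)"
  by (simp add: o_inv_distrib)

lemma inv_less_adj:
  assumes "bij u" "inv u x < inv u y" "\<not> (x = u i \<and> y = u (Suc i))"
  shows "inv (u \<circ> adj i) x < inv (u \<circ> adj i) y"
  unfolding inv_comp_adj[OF assms(1)] using assms by (metis adj_less bij_inv_eq_iff)

lemma inversion_adj:
  fixes u :: "nat \<Rightarrow> nat"
  assumes "bij u" "u i < u (Suc i)" "x < y" "inv u y < inv u x"
  shows "inv (u \<circ> adj i) y < inv (u \<circ> adj i) x"
  by (rule inv_less_adj[OF assms(1,4)]) (metis assms(2,3) order.asym)

text \<open>An ascending step only swaps a smaller entry with a larger one on its right, so it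
  cannot undo an inversion.\<close>

lemma inversion_persists:
  assumes "bij u" "ascending n u \<rho>" "x < y" "inv u y < inv u x"
  shows "inv (u \<circ> word_perm \<rho>) y < inv (u \<circ> word_perm \<rho>) x"
  using assms
proof (induction \<rho> arbitrary: u)
  case (Cons i \<rho>)
  have *: "u i < u (Suc i)" "ascending n (u \<circ> adj i) \<rho>" using Cons.prems(2) by simp_all
  show ?case unfolding comp_word_perm_Cons
    by (rule Cons.IH[OF bij_comp_adj[OF Cons.prems(1)] *(2) Cons.prems(3)])
      (rule inversion_adj[OF Cons.prems(1) *(1) Cons.prems(3,4)])
qed auto

lemma triples_less: "ascending n u \<rho> \<Longrightarrow> (x, y, z) \<in> triples u \<rho> \<Longrightarrow> x < y \<and> y < z"
  by (induction \<rho> arbitrary: u) (auto simp: step_triples_def)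

text \<open>Collecting a triple means swapping x < y while x is still on the left; as inversions
  persist, x was on the left from the start.\<close>

lemma triples_not_inverted:
  assumes "bij u" "ascending n u \<rho>" "(x, y, z) \<in> triples u \<rho>"
  shows "inv u x < inv u y"
  using assms
proof (induction \<rho> arbitrary: u)
  case (Cons i \<rho>)
  have less: "x < y" using triples_less Cons.prems by blast
  from Cons.prems(3) consider "(x, y, z) \<in> step_triples u i" | "(x, y, z) \<in> triples (u \<circ> adj i) \<rho>"
    by auto
  then show ?case
  proof cases
    case 1
    then show ?thesis using Cons.prems(1) by (auto simp: step_triples_def inv_f_f bij_is_inj)
  next
    case 2
    have "inv (u \<circ> adj i) x < inv (u \<circ> adj i) y"
      using Cons.IH[OF bij_comp_adj[OF Cons.prems(1)] _ 2] Cons.prems(2)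
      unfolding ascending.simps by blast
    then have "\<not> inv u y < inv u x"
      using inversion_adj[OF Cons.prems(1) _ less, of i] Cons.prems(2) by auto
    moreover have "inv u x \<noteq> inv u y"
      using less Cons.prems(1) by (metis bij_inv_eq_iff order.irrefl)
    ultimately show ?thesis by simp
  qed
qed auto

lemma step_triples_adj_inverted:
  assumes "bij u" "(x, y, z) \<in> step_triples u i"
  shows "inv (u \<circ> adj i) y < inv (u \<circ> adj i) x" "inv (u \<circ> adj i) z < inv (u \<circ> adj i) y"
  using assms by (auto simp: inv_comp_adj step_triples_def inv_f_f bij_is_inj)

text \<open>Just after the collecting swap the entries stand in the order z, y, x, and these
  inversions persist.\<close>

lemma triples_subset_triples321:
  assumes "bij u" "ascending n u \<rho>"
  shows "triples u \<rho> \<subseteq> triples321 (u \<circ> word_perm \<rho>)"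
  using assms
proof (induction \<rho> arbitrary: u)
  case (Cons i \<rho>)
  have asc: "ascending n (u \<circ> adj i) \<rho>" using Cons.prems(2) by simp
  have "t \<in> triples321 (u \<circ> adj i \<circ> word_perm \<rho>)" if "t \<in> step_triples u i" for t
  proof -
    obtain x y z where t: "t = (x, y, z)" by (cases t)
    have "x < y" "y < z" using that Cons.prems by (auto simp: t step_triples_def)
    moreover note step_triples_adj_inverted[OF Cons.prems(1) that[unfolded t]]
    ultimately show ?thesis
      using inversion_persists[OF bij_comp_adj[OF Cons.prems(1)] asc] unfolding t triples321_def
      by blast
  qed
  with Cons.IH[OF bij_comp_adj[OF Cons.prems(1)] asc] show ?case
    unfolding comp_word_perm_Cons triples.simps by blast
qed auto

text \<open>The entries x and y are swapped only once, so no triple is collected twice and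
  cardinalities add up along a word.\<close>

lemma step_triples_disjoint:
  assumes "bij u" "ascending n (u \<circ> adj i) \<rho>"
  shows "step_triples u i \<inter> triples (u \<circ> adj i) \<rho> = {}"
proof -
  have False if "t \<in> step_triples u i" "t \<in> triples (u \<circ> adj i) \<rho>" for t
  proof -
    obtain x y z where t: "t = (x, y, z)" by (cases t)
    show False
      using step_triples_adj_inverted[OF assms(1) that(1)[unfolded t]]
        triples_not_inverted[OF bij_comp_adj[OF assms(1)] assms(2) that(2)[unfolded t]] by simp
  qed
  then show ?thesis by blast
qed

text \<open>Since z is already left of y, it stays so until x and y are swapped; at that moment
  these are adjacent, so z is left of both.\<close>

lemma triplesI:
  assumes "bij u" "ascending n u \<rho>" "x < y" "y < z"
    and "inv u z < inv u y" "inv u x < inv u y"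
    and "inv (u \<circ> word_perm \<rho>) y < inv (u \<circ> word_perm \<rho>) x"
  shows "(x, y, z) \<in> triples u \<rho>"
  using assms
proof (induction \<rho> arbitrary: u)
  case (Cons i \<rho>)
  show ?case
  proof (cases "x = u i \<and> y = u (Suc i)")
    case True
    then have "inv u x = i" "inv u y = Suc i" using Cons.prems(1) by (auto simp: inv_f_f bij_is_inj)
    moreover have "inv u z \<noteq> inv u x" using Cons.prems(1,3,4) by (metis bij_inv_eq_iff order.strict_trans order.irrefl)
    ultimately have "inv u z < i" using Cons.prems(5) by auto
    then show ?thesis using True Cons.prems by (auto simp: step_triples_def)
  next
    case False
    have "(x, y, z) \<in> triples (u \<circ> adj i) \<rho>"
    proof (rule Cons.IH[OF bij_comp_adj[OF Cons.prems(1)] _ Cons.prems(3,4)])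
      show "ascending n (u \<circ> adj i) \<rho>" using Cons.prems(2) by simp
      show "inv (u \<circ> adj i) x < inv (u \<circ> adj i) y" by (rule inv_less_adj[OF Cons.prems(1,6) False])
      show "inv (u \<circ> adj i) z < inv (u \<circ> adj i) y"
        by (rule inversion_adj[OF Cons.prems(1) _ Cons.prems(4,5)]) (use Cons.prems(2) in simp)
      show "inv (u \<circ> adj i \<circ> word_perm \<rho>) y < inv (u \<circ> adj i \<circ> word_perm \<rho>) x"
        using Cons.prems(7) unfolding comp_word_perm_Cons .
    qed
    then show ?thesis by simp
  qed
qed auto

subsection \<open>The sum of indices\<close>

text \<open>Counts the positions \<open>q < r < s\<close> such that \<open>u s\<close> exceeds both \<open>u q\<close> and \<open>u r\<close>.\<close>

definition dominated_pairs :: "nat \<Rightarrow> (nat \<Rightarrow> nat) \<Rightarrow> nat" where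
  "dominated_pairs n u = (\<Sum>s = 1..n. card {q \<in> {1..<s}. u q < u s} choose 2)"

text \<open>Of the i - 1 entries left of position i, those above \<open>u (Suc i)\<close> give the
  step triples and the others are below it.\<close>

lemma card_step_triples:
  assumes "bij u" "u 0 = 0" "0 < i" "u i < u (Suc i)"
  shows "i = Suc (card {q \<in> {1..<i}. u q < u (Suc i)} + card (step_triples u i))"
proof -
  have "step_triples u i = (\<lambda>q. (u i, u (Suc i), u q)) ` {q \<in> {1..<i}. u (Suc i) < u q}"
  proof (intro equalityI subsetI)
    fix t assume "t \<in> step_triples u i"
    then obtain z where z: "t = (u i, u (Suc i), z)" "u (Suc i) < z" "inv u z < i"
      by (auto simp: step_triples_def)
    have uz: "u (inv u z) = z" using assms(1) by (metis bij_inv_eq_iff)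
    \<comment> \<open>\<open>step_triples\<close> also admits position 0; its entry 0 is too small
      to be z.\<close>
    then have "inv u z \<noteq> 0" using z(2) assms(2) by (metis not_less0)
    with uz show "t \<in> (\<lambda>q. (u i, u (Suc i), u q)) ` {q \<in> {1..<i}. u (Suc i) < u q}"
      using z by (intro image_eqI[of _ _ "inv u z"]) auto
  next
    fix t assume "t \<in> (\<lambda>q. (u i, u (Suc i), u q)) ` {q \<in> {1..<i}. u (Suc i) < u q}"
    then show "t \<in> step_triples u i" using assms(1) by (auto simp: step_triples_def inv_f_f bij_is_inj)
  qed
  moreover have "inj_on (\<lambda>q. (u i, u (Suc i), u q)) {q \<in> {1..<i}. u (Suc i) < u q}"
    using bij_is_inj[OF assms(1)] by (auto intro!: inj_onI dest: injD)
  ultimately have "card (step_triples u i) = card {q \<in> {1..<i}. u (Suc i) < u q}"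
    by (simp add: card_image)
  moreover have "card {1..<i} = card ({q \<in> {1..<i}. u q < u (Suc i)} \<union> {q \<in> {1..<i}. u (Suc i) < u q})"
  proof (rule arg_cong[where f = card])
    have "u q < u (Suc i) \<or> u (Suc i) < u q" if "q \<in> {1..<i}" for q
      using injD[OF bij_is_inj[OF assms(1)], of q "Suc i"] that by fastforce
    then show "{1..<i} = {q \<in> {1..<i}. u q < u (Suc i)} \<union> {q \<in> {1..<i}. u (Suc i) < u q}"
      by blast
  qed
  moreover have "card ({q \<in> {1..<i}. u q < u (Suc i)} \<union> {q \<in> {1..<i}. u (Suc i) < u q}) =
      card {q \<in> {1..<i}. u q < u (Suc i)} + card {q \<in> {1..<i}. u (Suc i) < u q}"
    by (rule card_Un_disjoint) auto
  ultimately show ?thesis using assms(3) by simp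
qed

text \<open>Let k be the number of entries left of i below y = \<open>u (Suc i)\<close>. Moving y
  one place to the left changes its contribution from k + 1 choose 2 to k choose 2. The smaller
  entry keeps its contribution, and so do the entries elsewhere, which see the same set of earlier
  entries.\<close>

lemma dominated_pairs_adj:
  assumes "i \<in> {1..<n}" "u i < u (Suc i)"
  shows "dominated_pairs n u = dominated_pairs n (u \<circ> adj i) + card {q \<in> {1..<i}. u q < u (Suc i)}"
proof -
  define L where "L v s = card {q \<in> {1..<s}. v q < v s}" for v :: "nat \<Rightarrow> nat" and s
  have split: "dominated_pairs n v =
      (L v i choose 2) + (L v (Suc i) choose 2) + (\<Sum>s \<in> {1..n} - {i, Suc i}. L v s choose 2)" for v
  proof -
    have "{1..n} = insert i (insert (Suc i) ({1..n} - {i, Suc i}))" using assms(1) by auto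
    then have "dominated_pairs n v = (\<Sum>s \<in> insert i (insert (Suc i) ({1..n} - {i, Suc i})). L v s choose 2)"
      unfolding dominated_pairs_def L_def by simp
    then show ?thesis by (simp add: add.assoc)
  qed
  let ?v = "u \<circ> adj i"
  have "L ?v s = L u s" if "s \<noteq> i" "s \<noteq> Suc i" "1 \<le> s" for s
  proof -
    have "{q \<in> {1..<s}. ?v q < ?v s} = adj i ` {q \<in> {1..<s}. u q < u s}"
    proof (cases "s < i")
      case True
      then show ?thesis by (auto simp: image_iff transpose_def)
    next
      case False
      with that have s: "Suc i < s" by simp
      have *: "adj i q \<in> {1..<s} \<longleftrightarrow> q \<in> {1..<s}" for q
        using s assms(1) by (auto simp: transpose_def)
      have "adj i s = s" using s by (simp add: transpose_def)
      show ?thesis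
      proof (intro equalityI subsetI)
        fix q assume "q \<in> {q \<in> {1..<s}. ?v q < ?v s}"
        then have "adj i q \<in> {q \<in> {1..<s}. u q < u s}" using * \<open>adj i s = s\<close> by simp
        then show "q \<in> adj i ` {q \<in> {1..<s}. u q < u s}"
          by (metis image_eqI transpose_involutory)
      next
        fix q assume "q \<in> adj i ` {q \<in> {1..<s}. u q < u s}"
        then obtain r where "q = adj i r" "r \<in> {1..<s}" "u r < u s" by auto
        then show "q \<in> {q \<in> {1..<s}. ?v q < ?v s}"
          using *[of q] \<open>adj i s = s\<close> by simp
      qed
    qed
    then show ?thesis unfolding L_def by (simp add: card_image inj_on_subset[OF inj_transpose])
  qed
  then have rest: "(\<Sum>s \<in> {1..n} - {i, Suc i}. L ?v s choose 2) =
      (\<Sum>s \<in> {1..n} - {i, Suc i}. L u s choose 2)"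
    by (intro sum.cong) auto
  have "{q \<in> {1..<Suc i}. ?v q < ?v (Suc i)} = {q \<in> {1..<i}. u q < u i}"
    using assms(2) by (auto simp: less_Suc_eq transpose_def)
  then have 1: "L ?v (Suc i) = L u i" by (simp add: L_def)
  have "{q \<in> {1..<i}. ?v q < ?v i} = {q \<in> {1..<i}. u q < u (Suc i)}"
    by (auto simp: transpose_def)
  then have 2: "L ?v i = card {q \<in> {1..<i}. u q < u (Suc i)}" by (simp add: L_def)
  have "{q \<in> {1..<Suc i}. u q < u (Suc i)} = insert i {q \<in> {1..<i}. u q < u (Suc i)}"
    using assms by auto
  then have 3: "L u (Suc i) = Suc (card {q \<in> {1..<i}. u q < u (Suc i)})" by (simp add: L_def)
  have "(Suc k choose 2) = k + (k choose 2)" for k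
    by (simp add: numeral_2_eq_2)
  then show ?thesis unfolding split rest 1 2 3 by simp
qed

lemma finite_triples:
  assumes "bij u"
  shows "finite (triples u \<rho>)"
  using assms
proof (induction \<rho> arbitrary: u)
  case (Cons i \<rho>)
  have "step_triples u i \<subseteq> (\<lambda>q. (u i, u (Suc i), u q)) ` {..<i}"
  proof
    fix t assume "t \<in> step_triples u i"
    then obtain z where z: "t = (u i, u (Suc i), z)" "inv u z < i" by (auto simp: step_triples_def)
    have "u (inv u z) = z" using Cons.prems by (metis bij_inv_eq_iff)
    then show "t \<in> (\<lambda>q. (u i, u (Suc i), u q)) ` {..<i}"
      using z by (intro image_eqI[of _ _ "inv u z"]) auto
  qed
  then have "finite (step_triples u i)" by (rule finite_subset) simp
  with Cons.IH[OF bij_comp_adj[OF Cons.prems]] show ?case unfolding triples.simps by (rule finite_UnI[rotated])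
qed simp

text \<open>Each letter equals 1 plus the drop of \<open>dominated_pairs\<close> plus the number of
  triples collected by the swap; summing telescopes.\<close>

lemma sum_list_ascending:
  assumes "bij u" "u 0 = 0" "ascending n u \<rho>"
  shows "sum_list \<rho> + dominated_pairs n (u \<circ> word_perm \<rho>) =
    length \<rho> + dominated_pairs n u + card (triples u \<rho>)"
  using assms
proof (induction \<rho> arbitrary: u)
  case (Cons i \<rho>)
  have i: "i \<in> {1..<n}" "u i < u (Suc i)" and asc: "ascending n (u \<circ> adj i) \<rho>"
    using Cons.prems(3) by simp_all
  have "(u \<circ> adj i) 0 = 0" using Cons.prems(2) i(1) by (simp add: transpose_def)
  note IH = Cons.IH[OF bij_comp_adj[OF Cons.prems(1)] this asc]
  have "card (triples u (i # \<rho>)) = card (step_triples u i) + card (triples (u \<circ> adj i) \<rho>)"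
    unfolding triples.simps
    by (rule card_Un_disjoint[OF _ _ step_triples_disjoint[OF Cons.prems(1) asc]])
      (use finite_triples[OF Cons.prems(1), of "[i]"] finite_triples[OF bij_comp_adj[OF Cons.prems(1)]] in simp_all)
  moreover have "i = Suc (card {q \<in> {1..<i}. u q < u (Suc i)} + card (step_triples u i))"
    using card_step_triples[OF Cons.prems(1,2) _ i(2)] i(1) by simp
  moreover note dominated_pairs_adj[OF i] IH
  ultimately show ?case unfolding comp_word_perm_Cons sum_list.Cons list.size by linarith
qed simp

section \<open>Descents and decompositions with extremal sets of triples\<close>

text \<open>Going left from r, the first entry that is at least \<open>w q\<close> is the top of a
  descent.\<close>

lemma descent_above:
  fixes w :: "nat \<Rightarrow> nat"
  assumes "q < r" "w r < w q"
  shows "\<exists>d. q \<le> d \<and> d < r \<and> w (Suc d) < w d \<and> w q \<le> w d"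
  using assms
proof (induction r)
  case (Suc r)
  show ?case
  proof (cases "w q \<le> w r")
    case True
    with Suc.prems show ?thesis by (intro exI[of _ r]) auto
  next
    case False
    with Suc.prems have "q < r" by (metis less_Suc_eq order.refl)
    with Suc.IH False show ?thesis by (meson not_le less_SucI)
  qed
qed simp

text \<open>Going left from r, the entries do not increase until a descent is met, so its bottom is
  at most \<open>w r\<close>. One is met before passing q because \<open>w r < w q\<close>.\<close>

lemma descent_below:
  fixes w :: "nat \<Rightarrow> nat"
  assumes "q < r" "w r < w q"
  shows "\<exists>d. q \<le> d \<and> d < r \<and> w (Suc d) < w d \<and> w (Suc d) \<le> w r"
  using assms
proof (induction r)
  case (Suc r)
  show ?case
  proof (cases "w (Suc r) < w r")
    case True
    with Suc.prems show ?thesis by (intro exI[of _ r]) auto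
  next
    case False
    with Suc.prems have "w r < w q" "q < r" by (auto simp: less_Suc_eq)
    with Suc.IH obtain d where "q \<le> d" "d < r" "w (Suc d) < w d" "w (Suc d) \<le> w r" by blast
    with False show ?thesis by (intro exI[of _ d]) auto
  qed
qed simp

lemma descent_range:
  assumes "w permutes {1..n}" "w (Suc d) < w d"
  shows "d \<in> {1..<n}"
proof (rule ccontr)
  assume "d \<notin> {1..<n}"
  then consider "d = 0" | "d = n" "d \<noteq> 0" | "n < d" by fastforce
  then show False
  proof cases
    case 1
    then show False using assms permutes_not_in[OF assms(1), of 0] by simp
  next
    case 2
    then have "w d \<le> n" using permutes_in_image[OF assms(1), of d] by simp
    then show False using 2 assms(2) permutes_not_in[OF assms(1), of "Suc d"] by simp
  next
    case 3
    then show False using assms(2) permutes_not_in[OF assms(1)] by simp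
  qed
qed

text \<open>Without descents both \<open>w\<close> and its inverse are strictly increasing on the
  naturals, which gives x \<le> w x and w x \<le> x.\<close>

lemma permutes_no_descent_id:
  assumes "w permutes {1..n}" "\<And>d. \<not> w (Suc d) < w d"
  shows "w = id"
proof
  fix x
  have mono: "w q < w r" if "q < r" for q r
  proof -
    have "w q \<noteq> w r" using injD[OF permutes_inj[OF assms(1)], of q r] that by auto
    moreover have "\<not> w r < w q" using descent_above[OF that] assms(2) by blast
    ultimately show ?thesis by simp
  qed
  have "strict_mono w" using mono by (simp add: strict_mono_def)
  then have "x \<le> w x" by (rule strict_mono_imp_increasing)
  moreover have "strict_mono (inv w)"
  proof (rule strict_monoI)
    fix a b :: nat assume "a < b"
    moreover have "w (inv w a) = a" "w (inv w b) = b"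
      using permutes_inverses[OF assms(1)] by simp_all
    ultimately show "inv w a < inv w b" using mono by (metis not_less_iff_gr_or_eq)
  qed
  then have "w x \<le> inv w (w x)" by (rule strict_mono_imp_increasing)
  ultimately show "w x = id x" using permutes_inverses[OF assms(1)] by simp
qed

text \<open>Builds a decomposition from its end. The last letter may be any descent, so
  \<open>step\<close> is free to choose one that preserves \<open>P\<close>; removing it lowers the
  number of inversions.\<close>

lemma reduced_word_induct:
  assumes "w permutes {1..n}" "P id []"
    and step: "\<And>w. w permutes {1..n} \<Longrightarrow> \<exists>d. w (Suc d) < w d \<Longrightarrow>
      \<exists>i. w (Suc i) < w i \<and> (\<forall>\<rho>. word_perm \<rho> = w \<circ> adj i \<longrightarrow> P (w \<circ> adj i) \<rho> \<longrightarrow> P w (\<rho> @ [i]))"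
  shows "\<exists>\<rho>. ascending n id \<rho> \<and> word_perm \<rho> = w \<and> P w \<rho>"
  using assms(1)
proof (induction "card (inversions n w)" arbitrary: w rule: less_induct)
  case less
  show ?case
  proof (cases "\<exists>d. w (Suc d) < w d")
    case True
    from step[OF less.prems this] obtain i where i: "w (Suc i) < w i"
      "\<And>\<rho>. word_perm \<rho> = w \<circ> adj i \<Longrightarrow> P (w \<circ> adj i) \<rho> \<Longrightarrow> P w (\<rho> @ [i])" by blast
    have r: "i \<in> {1..<n}" using descent_range[OF less.prems i(1)] .
    then have "adj i permutes {1..n}" by (intro permutes_swap_id) auto
    then have "w \<circ> adj i permutes {1..n}" using less.prems by (rule permutes_compose)
    from less.hyps[OF _ this] card_inversions_adj_descent[OF r i(1)]
    obtain \<rho> where \<rho>: "ascending n id \<rho>" "word_perm \<rho> = w \<circ> adj i" "P (w \<circ> adj i) \<rho>"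
      by auto
    have "word_perm (\<rho> @ [i]) = w" by (simp add: word_perm_append \<rho>(2) comp_assoc)
    moreover have "ascending n id (\<rho> @ [i])"
      using \<rho>(1,2) r i(1) by (simp add: ascending_append)
    ultimately show ?thesis using i(2)[OF \<rho>(2,3)] by blast
  next
    case False
    then have "w = id" using permutes_no_descent_id[OF less.prems] by blast
    then show ?thesis using assms(2) by (intro exI[of _ "[]"]) simp
  qed
qed

lemma finite_descents: "w permutes {1..n} \<Longrightarrow> finite {d. w (Suc d) < w d}"
  by (rule finite_subset[of _ "{1..<n}"]) (blast intro: descent_range, simp)

text \<open>Ending with the descent of largest top entry leaves no larger entry to the left of the last swap.\<close>

lemma exists_reduced_word_no_triples:
  assumes "w permutes {1..n}"
  shows "\<exists>\<rho>. ascending n id \<rho> \<and> word_perm \<rho> = w \<and> triples id \<rho> = {}"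
proof (rule reduced_word_induct[OF assms, of "\<lambda>_ \<rho>. triples id \<rho> = {}"])
  fix w assume w: "w permutes {1..n}" and "\<exists>d. w (Suc d) < w d"
  then have "w ` {d. w (Suc d) < w d} \<noteq> {}" by auto
  from Max_in[OF finite_imageI[OF finite_descents[OF w]] this]
  obtain i where i: "w (Suc i) < w i" "w i = Max (w ` {d. w (Suc d) < w d})" by auto
  have max: "w d \<le> w i" if "w (Suc d) < w d" for d
    using that finite_descents[OF w] unfolding i(2) by (intro Max_ge) auto
  have bij: "bij w" using w by (rule permutes_bij)
  have "step_triples (w \<circ> adj i) i = {}"
  proof -
    have False if "w i < z" "inv (w \<circ> adj i) z < i" for z
    proof -
      have "inv w z < i" using that(2) unfolding inv_comp_adj[OF bij]
        by (auto simp: transpose_def split: if_splits)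
      moreover have z: "w (inv w z) = z" using permutes_inverses[OF w] by simp
      then have "w i < w (inv w z)" using that(1) by simp
      \<comment> \<open>An entry z standing left of the smaller \<open>w i\<close> forces a descent
        with top at least z, against the maximality of \<open>w i\<close>.\<close>
      ultimately obtain d where "w (Suc d) < w d" "w (inv w z) \<le> w d"
        using descent_above by blast
      with max[of d] that(1) z show False by simp
    qed
    then show ?thesis by (auto simp: step_triples_def)
  qed
  with i(1) show "\<exists>i. w (Suc i) < w i \<and> (\<forall>\<rho>. word_perm \<rho> = w \<circ> adj i \<longrightarrow>
      triples id \<rho> = {} \<longrightarrow> triples id (\<rho> @ [i]) = {})"
    by (intro exI[of _ i]) (auto simp: triples_append)
qed simp

text \<open>
  Ending with the descent of smallest bottom entry, the last swap is never that of the two larger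
  entries of a 321-pattern.
\<close>

lemma exists_reduced_word_all_triples:
  assumes "w permutes {1..n}"
  shows "\<exists>\<rho>. ascending n id \<rho> \<and> word_perm \<rho> = w \<and> triples321 w \<subseteq> triples id \<rho>"
proof (rule reduced_word_induct[OF assms, of "\<lambda>w \<rho>. triples321 w \<subseteq> triples id \<rho>"])
  fix w assume w: "w permutes {1..n}" and "\<exists>d. w (Suc d) < w d"
  then have "(\<lambda>d. w (Suc d)) ` {d. w (Suc d) < w d} \<noteq> {}" by auto
  from Min_in[OF finite_imageI[OF finite_descents[OF w]] this]
  obtain i where i: "w (Suc i) < w i" "w (Suc i) = Min ((\<lambda>d. w (Suc d)) ` {d. w (Suc d) < w d})"
    by auto
  have min: "w (Suc i) \<le> w (Suc d)" if "w (Suc d) < w d" for d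
    using that finite_descents[OF w] unfolding i(2) by (intro Min_le) auto
  have bij: "bij w" using w by (rule permutes_bij)
  have inv_w: "inv w (w a) = a" "w (inv w a) = a" for a
    using permutes_inverses[OF w] by simp_all
  have "(x, y, z) \<in> triples321 (w \<circ> adj i) \<union> step_triples (w \<circ> adj i) i"
    if "(x, y, z) \<in> triples321 w" for x y z
  proof -
    have t: "x < y" "y < z" "inv w z < inv w y" "inv w y < inv w x"
      using that by (auto simp: triples321_def)
    \<comment> \<open>If the last swap inverted z and y, the smaller x further right would force a
      descent with bottom at most x, below the minimum y.\<close>
    have ne: "\<not> (z = w i \<and> y = w (Suc i))"
    proof
      assume "z = w i \<and> y = w (Suc i)"
      then have "Suc i < inv w x" "w (inv w x) < w (Suc i)" using t inv_w by auto
      from descent_below[OF this] obtain d where "w (Suc d) < w d" "w (Suc d) \<le> x"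
        using inv_w by auto
      with min[of d] t \<open>z = w i \<and> y = w (Suc i)\<close> show False by simp
    qed
    show ?thesis
    \<comment> \<open>Either the last swap inverts y and x and collects the triple, or both
      inversions were present before it.\<close>
    proof (cases "y = w i \<and> x = w (Suc i)")
      case True
      then have "inv w z < i" using t inv_w by simp
      then have "inv (w \<circ> adj i) z < i" by (simp add: inv_comp_adj[OF bij])
      then show ?thesis using True t by (simp add: step_triples_def)
    next
      case False
      show ?thesis
        using inv_less_adj[OF bij t(3) ne] inv_less_adj[OF bij t(4) False] t
        by (simp add: triples321_def)
    qed
  qed
  with i(1) show "\<exists>i. w (Suc i) < w i \<and> (\<forall>\<rho>. word_perm \<rho> = w \<circ> adj i \<longrightarrow>
      triples321 (w \<circ> adj i) \<subseteq> triples id \<rho> \<longrightarrow> triples321 w \<subseteq> triples id (\<rho> @ [i]))"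
    by (intro exI[of _ i]) (auto simp: triples_append)
qed (auto simp: triples321_def)

subsection \<open>Commutation classes and triples\<close>

lemma commutation_Cons:
  "commutation_move\<^sup>*\<^sup>* \<sigma> \<tau> \<Longrightarrow> commutation_move\<^sup>*\<^sup>* (i # \<sigma>) (i # \<tau>)"
proof (induction rule: rtranclp_induct)
  case (step \<tau> \<upsilon>)
  from step.hyps(2) obtain us vs a b where
    "2 \<le> \<bar>int a - int b\<bar>" "\<tau> = us @ [a, b] @ vs" "\<upsilon> = us @ [b, a] @ vs"
    unfolding commutation_move_def by blast
  then have "commutation_move (i # \<tau>) (i # \<upsilon>)" unfolding commutation_move_def
    by (intro exI[of _ "i # us"] exI[of _ vs] exI[of _ a] exI[of _ b]) simp
  with step.IH show ?case by simp
qed simp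

lemma commutation_front:
  "\<forall>j\<in>set \<alpha>. 2 \<le> \<bar>int i - int j\<bar> \<Longrightarrow> commutation_move\<^sup>*\<^sup>* (\<alpha> @ i # \<beta>) (i # \<alpha> @ \<beta>)"
proof (induction \<alpha>)
  case (Cons a \<alpha>)
  then have "commutation_move\<^sup>*\<^sup>* (a # \<alpha> @ i # \<beta>) (a # i # \<alpha> @ \<beta>)"
    by (intro commutation_Cons) simp
  moreover have "commutation_move (a # i # \<alpha> @ \<beta>) (i # a # \<alpha> @ \<beta>)"
    using Cons.prems unfolding commutation_move_def
    by (intro exI[of _ "[]"] exI[of _ "\<alpha> @ \<beta>"] exI[of _ a] exI[of _ i]) auto
  ultimately show ?case by simp
qed simp

text \<open>Both swapped positions lie on the same side of j and j + 1, so the entries there and the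
  set of entries left of j are unchanged.\<close>

lemma step_triples_adj_far:
  assumes "bij u" "2 \<le> \<bar>int i - int j\<bar>"
  shows "step_triples (u \<circ> adj i) j = step_triples u j"
proof -
  have "inv (u \<circ> adj i) z < j \<longleftrightarrow> inv u z < j" for z
    unfolding inv_comp_adj[OF assms(1)] using assms(2) by (auto simp: transpose_def)
  moreover have "(u \<circ> adj i) j = u j" "(u \<circ> adj i) (Suc j) = u (Suc j)"
    using assms(2) by (auto simp: transpose_def)
  ultimately show ?thesis by (simp add: step_triples_def)
qed

lemma adj_commute: "2 \<le> \<bar>int i - int j\<bar> \<Longrightarrow> adj i \<circ> adj j = adj j \<circ> adj i"
  by (auto simp: fun_eq_iff transpose_def)

text \<open>Distant swaps collect the same triples in either order and lead to the same word, from
  which the common suffix continues. This is what allows a letter to be moved to the front in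
  \<open>commutation_if_triples_eq\<close>.\<close>

lemma commutation_invariants:
  assumes "bij u" "ascending n u \<sigma>" "commutation_move \<sigma> \<tau>"
  shows "ascending n u \<tau> \<and> word_perm \<tau> = word_perm \<sigma> \<and> triples u \<tau> = triples u \<sigma>"
proof -
  obtain us vs i j where far: "2 \<le> \<bar>int i - int j\<bar>"
    and eq: "\<sigma> = us @ i # j # vs" "\<tau> = us @ j # i # vs"
    using assms(3) unfolding commutation_move_def by auto
  define v where "v = u \<circ> word_perm us"
  have v: "bij v" unfolding v_def using assms(1) bij_word_perm by (rule bij_comp[rotated])
  have far': "2 \<le> \<bar>int j - int i\<bar>" using far by simp
  note comm = adj_commute[OF far]
  have "v \<circ> adj i \<circ> adj j = v \<circ> adj j \<circ> adj i" by (simp only: comp_assoc comm)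
  moreover have "(v \<circ> adj j) i = v i" "(v \<circ> adj j) (Suc i) = v (Suc i)"
    "(v \<circ> adj i) j = v j" "(v \<circ> adj i) (Suc j) = v (Suc j)"
    using far by (auto simp: transpose_def)
  ultimately have "ascending n v (i # j # vs) \<longleftrightarrow> ascending n v (j # i # vs)"
    unfolding ascending.simps by auto
  moreover have "triples v (i # j # vs) = triples v (j # i # vs)"
    unfolding triples.simps step_triples_adj_far[OF v far] step_triples_adj_far[OF v far']
      \<open>v \<circ> adj i \<circ> adj j = v \<circ> adj j \<circ> adj i\<close> by blast
  moreover have "word_perm (i # j # vs) = word_perm (j # i # vs)"
    unfolding word_perm.simps by (simp only: comp_assoc[symmetric] comm)
  ultimately show ?thesis
    using assms(2) unfolding eq ascending_append triples_append word_perm_append v_def by metis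
qed

lemma commutation_invariants_rtranclp:
  assumes "bij u" "commutation_move\<^sup>*\<^sup>* \<sigma> \<tau>" "ascending n u \<sigma>"
  shows "ascending n u \<tau> \<and> word_perm \<tau> = word_perm \<sigma> \<and> triples u \<tau> = triples u \<sigma>"
  using assms(2)
proof (induction rule: rtranclp_induct)
  case (step \<tau> \<upsilon>)
  then show ?case using commutation_invariants[OF assms(1), of n \<tau> \<upsilon>] by metis
qed (simp add: assms(3))

lemma inv_less_if_adj_less:
  fixes u :: "nat \<Rightarrow> nat"
  assumes "bij u" "u i < u (Suc i)" "x < y" "inv (u \<circ> adj i) x < inv (u \<circ> adj i) y"
  shows "inv u x < inv u y"
proof (rule ccontr)
  assume "\<not> inv u x < inv u y"
  moreover have "inv u x \<noteq> inv u y" using assms(1,3) by (metis bij_inv_eq_iff order.irrefl)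
  ultimately have "inv u y < inv u x" by simp
  from inversion_adj[OF assms(1-3) this] assms(4) show False by simp
qed

text \<open>
  No entry can cross the adjacent pair \<open>x y\<close> before its swap: it would cross \<open>x\<close> or \<open>y\<close> first and
  thereby create a 321-triple in the order that the hypotheses exclude.
\<close>

lemma swap_to_front:
  assumes "bij u" "ascending n u \<sigma>" "u i = x" "u (Suc i) = y" "x < y"
    and "inv (u \<circ> word_perm \<sigma>) y < inv (u \<circ> word_perm \<sigma>) x"
    and "\<And>z. z < x \<Longrightarrow> inv u z < inv u x \<Longrightarrow>
      inv (u \<circ> word_perm \<sigma>) x < inv (u \<circ> word_perm \<sigma>) z \<Longrightarrow> (z, x, y) \<in> triples u \<sigma>"
    and "\<And>z. y < z \<Longrightarrow> inv u y < inv u z \<Longrightarrow> (x, y, z) \<notin> triples u \<sigma>"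
  shows "\<exists>\<alpha> \<beta>. \<sigma> = \<alpha> @ i # \<beta> \<and> (\<forall>j\<in>set \<alpha>. 2 \<le> \<bar>int i - int j\<bar>)"
  using assms
proof (induction \<sigma> arbitrary: u)
  case Nil
  have "inv u x = i" "inv u y = Suc i" using Nil.prems(1,3,4) by (auto simp: inv_f_f bij_is_inj)
  with Nil.prems(6) show ?case by simp
next
  case (Cons j \<sigma>)
  let ?v = "u \<circ> adj j"
  note bij = \<open>bij u\<close>
  have v: "bij ?v" using bij_comp_adj bij .
  have j: "u j < u (Suc j)" "ascending n ?v \<sigma>" using Cons.prems(2) by simp_all
  note end_eq = comp_word_perm_Cons[of u j \<sigma>]
  have pos: "inv u x = i" "inv u y = Suc i" "\<And>a. inv u (u a) = a"
    using Cons.prems(1,3,4) by (auto simp: inv_f_f bij_is_inj)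
  consider "j = i" | "j = Suc i" | "i = Suc j" | "2 \<le> \<bar>int i - int j\<bar>" by linarith
  then show ?case
  proof cases
    case 1
    then show ?thesis by (intro exI[of _ "[]"] exI[of _ \<sigma>]) auto
  next
    \<comment> \<open>Swapping y with the larger z on its right puts z between x and y, so the later
      swap of x and y would collect (x, y, z).\<close>
    case 2
    define z where "z = u (Suc (Suc i))"
    have "y < z" using j(1) 2 Cons.prems(4) by (simp add: z_def)
    have "(x, y, z) \<in> triples ?v \<sigma>"
    proof (rule triplesI[OF v j(2) \<open>x < y\<close> \<open>y < z\<close>])
      show "inv ?v z < inv ?v y" "inv ?v x < inv ?v y"
        unfolding inv_comp_adj[OF bij] using 2 pos by (simp_all add: z_def)
      show "inv (?v \<circ> word_perm \<sigma>) y < inv (?v \<circ> word_perm \<sigma>) x"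
        using Cons.prems(6) unfolding end_eq .
    qed
    moreover have "(x, y, z) \<notin> triples u (j # \<sigma>)"
      using Cons.prems(8)[OF \<open>y < z\<close>] pos by (simp add: z_def)
    ultimately show ?thesis by simp
  next
    \<comment> \<open>Swapping x with the smaller z on its left inverts z and x while y is still
      right of x, so (z, x, y) can no longer be collected, although it has to be.\<close>
    case 3
    define z where "z = u j"
    have "z < x" using j(1) 3 Cons.prems(3) by (simp add: z_def)
    have inv_v: "inv ?v x < inv ?v z"
      unfolding inv_comp_adj[OF bij] using 3 pos by (simp add: z_def)
    have "(z, x, y) \<in> triples u (j # \<sigma>)"
    proof (rule Cons.prems(7)[OF \<open>z < x\<close>])
      show "inv u z < inv u x" using 3 pos by (simp add: z_def)
      show "inv (u \<circ> word_perm (j # \<sigma>)) x < inv (u \<circ> word_perm (j # \<sigma>)) z"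
        unfolding end_eq by (rule inversion_persists[OF v j(2) \<open>z < x\<close> inv_v])
    qed
    moreover have "(z, x, y) \<notin> step_triples u j" using pos 3 by (simp add: step_triples_def)
    ultimately have "(z, x, y) \<in> triples ?v \<sigma>" by simp
    from triples_not_inverted[OF v j(2) this] inv_v show ?thesis by simp
  next
    case 4
    have "\<exists>\<alpha> \<beta>. \<sigma> = \<alpha> @ i # \<beta> \<and> (\<forall>j\<in>set \<alpha>. 2 \<le> \<bar>int i - int j\<bar>)"
    proof (rule Cons.IH[OF v j(2) _ _ \<open>x < y\<close>])
      show "?v i = x" "?v (Suc i) = y" using 4 Cons.prems(3,4) by (auto simp: transpose_def)
      show "inv (?v \<circ> word_perm \<sigma>) y < inv (?v \<circ> word_perm \<sigma>) x"
        using Cons.prems(6) unfolding end_eq .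
    next
      fix z assume z: "z < x" "inv ?v z < inv ?v x"
        "inv (?v \<circ> word_perm \<sigma>) x < inv (?v \<circ> word_perm \<sigma>) z"
      have "(z, x, y) \<in> triples u (j # \<sigma>)"
        by (rule Cons.prems(7)[OF z(1) inv_less_if_adj_less[OF bij j(1) z(1,2)]])
          (use z(3) in \<open>unfold end_eq\<close>)
      moreover have "(z, x, y) \<notin> step_triples u j"
        using pos 4 by (auto simp: step_triples_def)
      ultimately show "(z, x, y) \<in> triples ?v \<sigma>" by simp
    next
      fix z assume z: "y < z" "inv ?v y < inv ?v z"
      have "(x, y, z) \<notin> triples u (j # \<sigma>)"
        by (rule Cons.prems(8)[OF z(1) inv_less_if_adj_less[OF bij j(1) z]])
      then show "(x, y, z) \<notin> triples ?v \<sigma>" by simp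
    qed
    then obtain \<alpha> \<beta> where "\<sigma> = \<alpha> @ i # \<beta>" "\<forall>j\<in>set \<alpha>. 2 \<le> \<bar>int i - int j\<bar>" by blast
    with 4 show ?thesis by (intro exI[of _ "j # \<alpha>"] exI[of _ \<beta>]) simp
  qed
qed

text \<open>Induction on \<open>\<tau>\<close>: its first letter can be moved to the front of
  \<open>\<sigma>\<close> by commutations and cancelled, leaving words with equal triples.\<close>

lemma commutation_if_triples_eq:
  assumes "bij u" "ascending n u \<sigma>" "ascending n u \<tau>" "word_perm \<sigma> = word_perm \<tau>"
    and "triples u \<sigma> = triples u \<tau>"
  shows "commutation_move\<^sup>*\<^sup>* \<sigma> \<tau>"
  using assms
proof (induction \<tau> arbitrary: u \<sigma>)
  case Nil
  have "card (inversions n (u \<circ> word_perm \<sigma>)) = card (inversions n u) + length \<sigma>"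
    using card_inversions_le[OF bij_is_inj[OF Nil.prems(1)] ascending_set[OF Nil.prems(2)]]
      Nil.prems(2) by blast
  then have "\<sigma> = []" unfolding Nil.prems(4) word_perm.simps comp_id by simp
  then show ?case by simp
next
  case (Cons i \<tau>)
  let ?v = "u \<circ> adj i"
  define x y where "x = u i" "y = u (Suc i)"
  note bij = \<open>bij u\<close>
  have v: "bij ?v" using bij_comp_adj bij .
  have i: "u i < u (Suc i)" "ascending n ?v \<tau>" using Cons.prems(3) by simp_all
  then have "x < y" by (simp add: x_y_def)
  have pos: "inv u x = i" "inv u y = Suc i" using bij by (auto simp: x_y_def inv_f_f bij_is_inj)
  have pos_v: "inv ?v x = Suc i" "inv ?v y = i" using pos by (simp_all add: inv_comp_adj[OF bij])
  have end_eq: "u \<circ> word_perm \<sigma> = ?v \<circ> word_perm \<tau>"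
    unfolding Cons.prems(4) comp_word_perm_Cons ..
  have end_xy: "inv (?v \<circ> word_perm \<tau>) y < inv (?v \<circ> word_perm \<tau>) x"
    by (rule inversion_persists[OF v i(2) \<open>x < y\<close>]) (simp add: pos_v)
  have "\<exists>\<alpha> \<beta>. \<sigma> = \<alpha> @ i # \<beta> \<and> (\<forall>j\<in>set \<alpha>. 2 \<le> \<bar>int i - int j\<bar>)"
  proof (rule swap_to_front[OF bij Cons.prems(2) _ _ \<open>x < y\<close>])
    show "u i = x" "u (Suc i) = y" by (simp_all add: x_y_def)
    show "inv (u \<circ> word_perm \<sigma>) y < inv (u \<circ> word_perm \<sigma>) x" using end_xy unfolding end_eq .
  next
    \<comment> \<open>\<open>i # \<tau>\<close> swaps x and y first, so y is already left of x when
      z and x are swapped.\<close>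
    fix z assume z: "z < x" "inv u z < inv u x"
      "inv (u \<circ> word_perm \<sigma>) x < inv (u \<circ> word_perm \<sigma>) z"
    have "(z, x, y) \<in> triples ?v \<tau>"
    proof (rule triplesI[OF v i(2) z(1) \<open>x < y\<close>])
      show "inv ?v y < inv ?v x" by (simp add: pos_v)
      show "inv ?v z < inv ?v x" using z(2) pos unfolding pos_v by (simp add: inv_comp_adj[OF bij])
      show "inv (?v \<circ> word_perm \<tau>) x < inv (?v \<circ> word_perm \<tau>) z" using z(3) unfolding end_eq .
    qed
    then show "(z, x, y) \<in> triples u \<sigma>" using Cons.prems(5) by simp
  next
    \<comment> \<open>Here z is right of y at the first swap, and x and y are never swapped
      again.\<close>
    fix z assume z: "y < z" "inv u y < inv u z"
    have "(x, y, z) \<notin> step_triples u i" using z(2) pos by (simp add: step_triples_def)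
    moreover have "(x, y, z) \<notin> triples ?v \<tau>"
      using triples_not_inverted[OF v i(2), of x y z] by (auto simp: pos_v)
    ultimately show "(x, y, z) \<notin> triples u \<sigma>" using Cons.prems(5) by simp
  qed
  then obtain \<alpha> \<beta> where \<sigma>: "\<sigma> = \<alpha> @ i # \<beta>" "\<forall>j\<in>set \<alpha>. 2 \<le> \<bar>int i - int j\<bar>" by blast
  have front: "commutation_move\<^sup>*\<^sup>* \<sigma> (i # \<alpha> @ \<beta>)" unfolding \<sigma>(1) by (rule commutation_front[OF \<sigma>(2)])
  note inv = commutation_invariants_rtranclp[OF bij front Cons.prems(2)]
  have *: "ascending n ?v (\<alpha> @ \<beta>)" "word_perm (i # \<alpha> @ \<beta>) = word_perm (i # \<tau>)"
    "triples u (i # \<alpha> @ \<beta>) = triples u (i # \<tau>)"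
    using inv Cons.prems(4,5) unfolding ascending.simps by metis+
  have "adj i \<circ> word_perm (i # \<alpha> @ \<beta>) = adj i \<circ> word_perm (i # \<tau>)" unfolding *(2) ..
  then have wp: "word_perm (\<alpha> @ \<beta>) = word_perm \<tau>"
    unfolding word_perm.simps comp_assoc[symmetric] by simp
  \<comment> \<open>Both words collect the same triples at their first letter, disjoint from all
    later ones, so these can be removed from both sides.\<close>
  have "triples ?v (\<alpha> @ \<beta>) = triples ?v \<tau>"
    using *(3) step_triples_disjoint[OF bij *(1)] step_triples_disjoint[OF bij i(2)]
    unfolding triples.simps by blast
  from commutation_Cons[OF Cons.IH[OF v *(1) i(2) wp this]] front
  show ?case by (meson rtranclp_trans)
qed

subsection \<open>Induced decompositions\<close>

lemma strict_mono_on_image_eq: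
  fixes f g :: "nat \<Rightarrow> nat"
  assumes "strict_mono_on {1..m} f" "strict_mono_on {1..m} g" "f ` {1..m} = g ` {1..m}" "j \<in> {1..m}"
  shows "f j = g j"
proof -
  have sorted: "sorted (map h [1..<Suc m]) \<and> distinct (map h [1..<Suc m])"
    if "strict_mono_on {1..m} h" for h :: "nat \<Rightarrow> nat"
  proof -
    have "sorted_wrt (<) (map h [1..<Suc m])" unfolding sorted_wrt_map
      by (rule sorted_wrt_mono_rel[OF _ sorted_wrt_upt]) (use that in \<open>auto simp: strict_mono_on_def\<close>)
    then show ?thesis by (simp only: strict_sorted_iff)
  qed
  have set: "set [1..<Suc m] = {1..m}" by auto
  have "map f [1..<Suc m] = map g [1..<Suc m]"
  proof (rule sorted_distinct_set_unique)
    from set show "set (map f [1..<Suc m]) = set (map g [1..<Suc m])" using assms(3) by (simp only: set_map)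
  qed (use sorted[OF assms(1)] sorted[OF assms(2)] in blast)+
  then show ?thesis using assms(4) unfolding map_eq_conv set by blast
qed

text \<open>Identifies the count recorded by \<open>induced_from\<close> with the index in the
  increasing enumeration of positions; the condition on 0 matches a count that starts at position
  1.\<close>

lemma card_strict_mono_on_prefix:
  fixes f :: "nat \<Rightarrow> nat"
  assumes "strict_mono_on {1..m} f" "f ` {1..m} = {q. P q}" "\<not> P 0" "j \<in> {1..m}"
  shows "card {q \<in> {1..f j}. P q} = j"
proof -
  have "{q \<in> {1..f j}. P q} = f ` {1..j}"
  proof (intro equalityI subsetI)
    fix q assume q: "q \<in> {q \<in> {1..f j}. P q}"
    then have "q \<in> f ` {1..m}" unfolding assms(2) by simp
    then obtain t where t: "t \<in> {1..m}" "q = f t" by blast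
    have "t \<le> j" using q t strict_mono_on_less_eq[OF assms(1) t(1) assms(4)] by simp
    with t show "q \<in> f ` {1..j}" by simp
  next
    fix q assume "q \<in> f ` {1..j}"
    then obtain t where t: "t \<in> {1..j}" "q = f t" by blast
    then have tm: "t \<in> {1..m}" using assms(4) by simp
    then have "f t \<in> {q. P q}" unfolding assms(2)[symmetric] by blast
    then have "P q" using t(2) by simp
    moreover have "q \<noteq> 0" using \<open>P q\<close> assms(3) by (cases q) auto
    moreover have "q \<le> f j" using t strict_mono_on_less_eq[OF assms(1) tm assms(4)] by simp
    ultimately show "q \<in> {q \<in> {1..f j}. P q}" by simp
  qed
  moreover have "inj_on f {1..j}"
    using strict_mono_on_imp_inj_on[OF assms(1)] by (rule inj_on_subset) (use assms(4) in auto)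
  ultimately show ?thesis by (simp add: card_image)
qed

definition map_triple :: "(nat \<Rightarrow> nat) \<Rightarrow> nat \<times> nat \<times> nat \<Rightarrow> nat \<times> nat \<times> nat" where
  "map_triple e = (\<lambda>(x, y, z). (e x, e y, e z))"

text \<open>
  Here \<open>e\<close> enumerates \<open>A\<close> increasingly and \<open>f\<close> the positions of its entries in the word \<open>u\<close>, so
  that \<open>v\<close> is the standardization of the subword of \<open>u\<close> with entries in \<open>A\<close>.
\<close>

definition standardizes ::
    "nat \<Rightarrow> nat set \<Rightarrow> (nat \<Rightarrow> nat) \<Rightarrow> (nat \<Rightarrow> nat) \<Rightarrow> (nat \<Rightarrow> nat) \<Rightarrow> (nat \<Rightarrow> nat) \<Rightarrow> bool" where
  "standardizes m A e f u v \<longleftrightarrow> v permutes {1..m} \<and> strict_mono_on {1..m} f \<and>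
    f ` {1..m} = {q. u q \<in> A} \<and> (\<forall>j\<in>{1..m}. u (f j) = e (v j))"

text \<open>The two swapped positions are consecutive among those of \<open>A\<close>, so the swap
  acts on the standardization at \<open>j\<close>. As \<open>e\<close> and \<open>f\<close> are
  increasing, comparisons of values and positions transfer, and with them the step triples.\<close>

lemma standardizes_both:
  assumes "bij u" "u 0 \<notin> A" "u i < u (Suc i)" "strict_mono_on {1..m} e"
    and st: "standardizes m A e f u v" and A: "u i \<in> A" "u (Suc i) \<in> A"
  defines "j \<equiv> card {q \<in> {1..i}. u q \<in> A}"
  shows "j \<in> {1..<m}" and "v j < v (Suc j)"
    and "step_triples u i \<inter> A \<times> A \<times> A = map_triple e ` step_triples v j"
    and "standardizes m A e f (u \<circ> adj i) (v \<circ> adj j)"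
proof -
  have v: "v permutes {1..m}" and f: "strict_mono_on {1..m} f" "f ` {1..m} = {q. u q \<in> A}"
    and uf: "\<And>j. j \<in> {1..m} \<Longrightarrow> u (f j) = e (v j)"
    using st by (auto simp: standardizes_def)
  have "i \<in> f ` {1..m}" "Suc i \<in> f ` {1..m}" unfolding f(2) using A by simp_all
  then obtain a b where a: "a \<in> {1..m}" "i = f a" and b: "b \<in> {1..m}" "Suc i = f b" by blast
  have ja: "j = a"
    using card_strict_mono_on_prefix[OF f assms(2) a(1)] unfolding j_def a(2) .
  have "a < b" using strict_mono_on_less[OF f(1) a(1) b(1)] a(2) b(2) by simp
  \<comment> \<open>No position lies strictly between i and i + 1.\<close>
  have "b = Suc a"
  proof (rule ccontr)
    assume "b \<noteq> Suc a"
    then have "Suc a < b" "Suc a \<in> {1..m}" using \<open>a < b\<close> b(1) by auto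
    then have "f a < f (Suc a)" "f (Suc a) < f b"
      using strict_mono_on_less[OF f(1)] a(1) b(1) by auto
    then show False using a(2) b(2) by simp
  qed
  have j: "j \<in> {1..m}" "Suc j \<in> {1..m}" "f j = i" "f (Suc j) = Suc i"
    using a b ja \<open>b = Suc a\<close> by simp_all
  then show "j \<in> {1..<m}" by simp
  have ev: "e (v j) = u i" "e (v (Suc j)) = u (Suc i)"
    using uf[OF j(1)] uf[OF j(2)] j(3,4) by simp_all
  have v_in: "v t \<in> {1..m}" if "t \<in> {1..m}" for t using permutes_in_image[OF v] that by simp
  have e_less: "e (v s) < e (v t) \<longleftrightarrow> v s < v t" if "s \<in> {1..m}" "t \<in> {1..m}" for s t
    by (rule strict_mono_on_less[OF assms(4) v_in[OF that(1)] v_in[OF that(2)]])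
  show "v j < v (Suc j)" using e_less[OF j(1,2)] assms(3) unfolding ev by simp
  have inv_u: "inv u (u q) = q" "u (inv u q) = q" for q
    using assms(1) by (simp_all add: inv_f_f bij_is_inj surj_f_inv_f bij_is_surj)
  have inv_v: "inv v (v q) = q" "v (inv v q) = q" for q
    using permutes_inverses[OF v] by simp_all
  show "step_triples u i \<inter> A \<times> A \<times> A = map_triple e ` step_triples v j"
  proof (intro equalityI subsetI)
    fix s assume "s \<in> step_triples u i \<inter> A \<times> A \<times> A"
    then obtain z where z: "s = (u i, u (Suc i), z)" "u (Suc i) < z" "inv u z < i" "z \<in> A"
      by (auto simp: step_triples_def)
    then have "inv u z \<in> f ` {1..m}" unfolding f(2) by (simp add: inv_u)
    then obtain t where t: "t \<in> {1..m}" "inv u z = f t" by blast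
    then have "z = e (v t)" using uf[OF t(1)] inv_u(2)[of z] by simp
    then have "v (Suc j) < v t" using z(2) e_less[OF j(2) t(1)] unfolding ev by simp
    moreover have "t < j" using strict_mono_on_less[OF f(1) t(1) j(1)] t(2) z(3) j(3) by simp
    ultimately have "(v j, v (Suc j), v t) \<in> step_triples v j"
      by (simp add: step_triples_def inv_v)
    moreover have "s = map_triple e (v j, v (Suc j), v t)"
      unfolding map_triple_def z(1) \<open>z = e (v t)\<close> ev[symmetric] by simp
    ultimately show "s \<in> map_triple e ` step_triples v j" by blast
  next
    fix s assume "s \<in> map_triple e ` step_triples v j"
    then obtain z where z: "s = (u i, u (Suc i), e z)" "v (Suc j) < z" "inv v z < j"
      by (auto simp: step_triples_def map_triple_def ev)
    define t where "t = inv v z"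
    have zt: "z = v t" by (simp add: t_def inv_v)
    \<comment> \<open>\<open>f\<close> enumerates from index 1 on, whereas
      \<open>step_triples v j\<close> admits position 0.\<close>
    have "v 0 = 0" using permutes_not_in[OF v, of 0] by simp
    then have "t \<noteq> 0" using z(2) zt by (cases t) auto
    then have t: "t \<in> {1..m}" "t < j" using z(3) j(1) by (auto simp: t_def)
    then have "f t < i" using strict_mono_on_less[OF f(1) t(1) j(1)] j(3) by simp
    moreover have "u (Suc i) < u (f t)"
      using z(2) e_less[OF j(2) t(1)] unfolding uf[OF t(1)] ev zt by simp
    moreover have "f t \<in> {q. u q \<in> A}" unfolding f(2)[symmetric] using t(1) by blast
    ultimately have "(u i, u (Suc i), u (f t)) \<in> step_triples u i \<inter> A \<times> A \<times> A"
      using A by (simp add: step_triples_def inv_u)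
    then show "s \<in> step_triples u i \<inter> A \<times> A \<times> A" unfolding z(1) zt uf[OF t(1)] .
  qed
  have "adj j permutes {1..m}" using j(1,2) by (rule permutes_swap_id)
  then have "v \<circ> adj j permutes {1..m}" using v by (rule permutes_compose)
  \<comment> \<open>The set of positions holding entries of \<open>A\<close> is unchanged, so the
    same \<open>f\<close> serves after the swap.\<close>
  moreover have "{q. (u \<circ> adj i) q \<in> A} = {q. u q \<in> A}"
    using A by (auto simp: transpose_def split: if_splits)
  moreover have "(u \<circ> adj i) (f t) = e ((v \<circ> adj j) t)" if t: "t \<in> {1..m}" for t
  proof -
    have "inj_on f {1..m}" using f(1) by (rule strict_mono_on_imp_inj_on)
    then have "f t = i \<longleftrightarrow> t = j" "f t = Suc i \<longleftrightarrow> t = Suc j"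
      using t j inj_on_eq_iff[of f "{1..m}"] by metis+
    then have "adj i (f t) = f (adj j t)" using j(3,4) by (auto simp: transpose_def)
    moreover have "adj j t \<in> {1..m}" using t j(1,2) by (auto simp: transpose_def)
    ultimately show ?thesis using uf by simp
  qed
  ultimately show "standardizes m A e f (u \<circ> adj i) (v \<circ> adj j)"
    using f by (simp add: standardizes_def)
qed

text \<open>At most one of the swapped positions holds an entry of \<open>A\<close>, so
  \<open>adj i\<close> is increasing on the positions of \<open>A\<close> and their relative order
  survives.\<close>

lemma standardizes_not_both:
  assumes "standardizes m A e f u v" "\<not> (u i \<in> A \<and> u (Suc i) \<in> A)"
  shows "standardizes m A e (adj i \<circ> f) (u \<circ> adj i) v"
proof -
  have v: "v permutes {1..m}" and f: "strict_mono_on {1..m} f" "f ` {1..m} = {q. u q \<in> A}"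
    and uf: "\<And>j. j \<in> {1..m} \<Longrightarrow> u (f j) = e (v j)"
    using assms(1) by (auto simp: standardizes_def)
  have fA: "u (f a) \<in> A" if "a \<in> {1..m}" for a
    using imageI[OF that, of f] unfolding f(2) by simp
  have "strict_mono_on {1..m} (adj i \<circ> f)"
  proof (rule strict_mono_onI)
    fix a b assume ab: "a \<in> {1..m}" "b \<in> {1..m}" "a < b"
    then have "f a < f b" using strict_mono_on_less[OF f(1)] by blast
    moreover have "\<not> (f a = i \<and> f b = Suc i)" using fA[OF ab(1)] fA[OF ab(2)] assms(2) by auto
    ultimately show "(adj i \<circ> f) a < (adj i \<circ> f) b" unfolding comp_apply by (rule adj_less)
  qed
  moreover have "(adj i \<circ> f) ` {1..m} = {q. (u \<circ> adj i) q \<in> A}"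
  proof -
    have "(adj i \<circ> f) ` {1..m} = adj i ` {q. u q \<in> A}" unfolding image_comp[symmetric] f(2) ..
    also have "\<dots> = {q. (u \<circ> adj i) q \<in> A}"
    proof (intro equalityI subsetI)
      fix q assume "q \<in> {q. (u \<circ> adj i) q \<in> A}"
      then have "adj i (adj i q) \<in> adj i ` {q. u q \<in> A}" by (intro imageI) simp
      then show "q \<in> adj i ` {q. u q \<in> A}" by simp
    qed auto
    finally show ?thesis .
  qed
  ultimately show ?thesis using v uf by (simp add: standardizes_def)
qed

text \<open>A swap within \<open>A\<close> becomes a letter of the induced word; any other swap
  collects no triple within \<open>A\<close> and leaves the standardization as it is.\<close>

lemma induced_from_simulation:
  assumes "bij u" "u 0 \<notin> A" "ascending n u \<rho>" "strict_mono_on {1..m} e" "standardizes m A e f u v"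
  shows "ascending m v (induced_from u A \<rho>) \<and>
    triples u \<rho> \<inter> A \<times> A \<times> A = map_triple e ` triples v (induced_from u A \<rho>) \<and>
    (\<exists>g. standardizes m A e g (u \<circ> word_perm \<rho>) (v \<circ> word_perm (induced_from u A \<rho>)))"
  using assms(1-3,5)
proof (induction \<rho> arbitrary: u v f)
  case (Cons i \<rho>)
  let ?u = "u \<circ> adj i"
  have i: "1 \<le> i" "u i < u (Suc i)" "ascending n ?u \<rho>" using Cons.prems(3) by simp_all
  have u: "bij ?u" "?u 0 \<notin> A" using bij_comp_adj[OF Cons.prems(1)] Cons.prems(2) i(1)
    by (auto simp: transpose_def)
  show ?case
  proof (cases "u i \<in> A \<and> u (Suc i) \<in> A")
    case True
    define j where "j = card {q \<in> {1..i}. u q \<in> A}"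
    note both = standardizes_both[OF Cons.prems(1,2) i(2) assms(4) Cons.prems(4), folded j_def]
    note both = both[OF conjunct1[OF True] conjunct2[OF True]]
    note IH = Cons.IH[OF u i(3) both(4)]
    have eq: "induced_from u A (i # \<rho>) = j # induced_from ?u A \<rho>" using True by (simp add: j_def)
    have "ascending m v (j # induced_from ?u A \<rho>)"
      unfolding ascending.simps using both(1,2) conjunct1[OF IH] by blast
    moreover have "triples u (i # \<rho>) \<inter> A \<times> A \<times> A = map_triple e ` triples v (j # induced_from ?u A \<rho>)"
      unfolding triples.simps Int_Un_distrib2 image_Un both(3) conjunct1[OF conjunct2[OF IH]] ..
    ultimately show ?thesis using IH unfolding eq comp_word_perm_Cons by blast
  next
    case False
    note IH = Cons.IH[OF u i(3) standardizes_not_both[OF Cons.prems(4) False]]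
    have eq: "induced_from u A (i # \<rho>) = induced_from ?u A \<rho>" using False by simp
    have "step_triples u i \<inter> A \<times> A \<times> A = {}" using False by (auto simp: step_triples_def)
    then have *: "triples u (i # \<rho>) \<inter> A \<times> A \<times> A = triples ?u \<rho> \<inter> A \<times> A \<times> A"
      unfolding triples.simps Int_Un_distrib2 by simp
    show ?thesis unfolding eq comp_word_perm_Cons * by (rule IH)
  qed
next
  case Nil
  have "standardizes m A e f (u \<circ> word_perm []) (v \<circ> word_perm [])"
    using Nil.prems(4) unfolding word_perm.simps comp_id .
  then show ?case by auto
qed

lemma induced_simulation:
  assumes "ascending n id \<rho>" "A \<subseteq> {1..n}" "card A = m"
  obtains e f where "strict_mono_on {1..m} e" "ascending m id (induced A \<rho>)"
    "triples id \<rho> \<inter> A \<times> A \<times> A = map_triple e ` triples id (induced A \<rho>)"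
    "standardizes m A e f (word_perm \<rho>) (word_perm (induced A \<rho>))"
proof -
  have "finite A" using assms(2) by (rule finite_subset) simp
  then obtain h where h: "bij_betw h {..<card A} A" "strict_mono_on {..<card A} h"
    by (rule ex_bij_betw_strict_mono_card)
  \<comment> \<open>\<open>h\<close> is indexed from 0, positions from 1.\<close>
  define e where "e = (\<lambda>j. h (j - 1))"
  have e: "strict_mono_on {1..m} e"
  proof (rule strict_mono_onI)
    fix a b assume "a \<in> {1..m}" "b \<in> {1..m}" "a < b"
    then show "e a < e b"
      using strict_mono_onD[OF h(2), of "a - 1" "b - 1"] assms(3) by (auto simp: e_def)
  qed
  have "(\<lambda>j. j - 1) ` {1..m} = {..<card A}"
    unfolding assms(3) by (auto intro!: image_eqI[of _ _ "Suc _"])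
  moreover have "e ` {1..m} = h ` (\<lambda>j. j - 1) ` {1..m}" unfolding e_def image_image ..
  ultimately have img: "e ` {1..m} = A" using bij_betw_imp_surj_on[OF h(1)] by simp
  \<comment> \<open>In the identity word each entry is its own position, so \<open>e\<close>
    enumerates the positions as well.\<close>
  have "standardizes m A e e id id"
    using e img by (auto simp: standardizes_def permutes_id)
  moreover have "id 0 \<notin> A" using assms(2) by auto
  ultimately have "ascending m id (induced A \<rho>) \<and>
    triples id \<rho> \<inter> A \<times> A \<times> A = map_triple e ` triples id (induced A \<rho>) \<and>
    (\<exists>g. standardizes m A e g (id \<circ> word_perm \<rho>) (id \<circ> word_perm (induced A \<rho>)))"
    using induced_from_simulation[OF bij_id _ assms(1) e, of A e id] unfolding induced_def by blast
  then show thesis using that[OF e] unfolding id_comp by blast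
qed

subsection \<open>Patterns and subnetworks\<close>

text \<open>A descent of \<open>v \<circ> inv p\<close> would be a pair ordered differently by
  \<open>v\<close> and \<open>p\<close>; without descents it is the identity.\<close>

lemma permutes_eq_if_order_iso:
  fixes v p :: "nat \<Rightarrow> nat"
  assumes "v permutes {1..m}" "p permutes {1..m}"
    and "\<And>h j. h \<in> {1..m} \<Longrightarrow> j \<in> {1..m} \<Longrightarrow> v h < v j \<longleftrightarrow> p h < p j"
  shows "v = p"
proof -
  have perm: "v \<circ> inv p permutes {1..m}"
    using permutes_inv[OF assms(2)] assms(1) by (rule permutes_compose)
  have pp: "p (inv p x) = x" for x using permutes_inverses[OF assms(2)] by simp
  have "v \<circ> inv p = id"
  proof (rule permutes_no_descent_id[OF perm])
    fix d show "\<not> (v \<circ> inv p) (Suc d) < (v \<circ> inv p) d"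
    proof
      assume *: "(v \<circ> inv p) (Suc d) < (v \<circ> inv p) d"
      have "d \<in> {1..<m}" by (rule descent_range[OF perm *])
      then have "inv p d \<in> {1..m}" "inv p (Suc d) \<in> {1..m}"
        using permutes_in_image[OF permutes_inv[OF assms(2)]] by simp_all
      from assms(3)[OF this(2,1)] * show False unfolding pp by simp
    qed
  qed
  then have "v \<circ> (inv p \<circ> p) = p" unfolding comp_assoc[symmetric] by simp
  then show ?thesis using permutes_inv_o(2)[OF assms(2)] by simp
qed

definition positions :: "(nat \<Rightarrow> nat) \<Rightarrow> nat \<times> nat \<times> nat \<Rightarrow> nat set" where
  "positions w = (\<lambda>(x, y, z). {inv w z, inv w y, inv w x})"

lemma mem_patterns321:
  "T \<in> patterns321 n w \<longleftrightarrow> (\<exists>q r s. 1 \<le> q \<and> q < r \<and> r < s \<and> s \<le> n \<and>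
    w s < w r \<and> w r < w q \<and> T = {q, r, s})"
proof
  have three: "{1..3} = {1, 2, 3::nat}" by auto
  have p: "perm321 1 = 3" "perm321 2 = 2" "perm321 3 = 1"
    by (simp_all add: perm321_def transpose_def)
  {
    assume "T \<in> patterns321 n w"
    then obtain i where i: "T = i ` {1..3}" "i ` {1..3} \<subseteq> {1..n}" "strict_mono_on {1..3} i"
      "\<And>h j. h \<in> {1..3} \<Longrightarrow> j \<in> {1..3} \<Longrightarrow> w (i h) < w (i j) \<longleftrightarrow> perm321 h < perm321 j"
      unfolding patterns321_def patterns_def by blast
    have "i 1 < i 2" "i 2 < i 3" by (rule strict_mono_onD[OF i(3)]; simp)+
    moreover have "w (i 3) < w (i 2)" "w (i 2) < w (i 1)"
      using i(4)[of 3 2] i(4)[of 2 1] p by simp_all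
    moreover have "1 \<le> i 1" "i 3 \<le> n" "T = {i 1, i 2, i 3}" using i(1,2) unfolding three by auto
    ultimately show "\<exists>q r s. 1 \<le> q \<and> q < r \<and> r < s \<and> s \<le> n \<and>
      w s < w r \<and> w r < w q \<and> T = {q, r, s}" by blast
  next
    assume "\<exists>q r s. 1 \<le> q \<and> q < r \<and> r < s \<and> s \<le> n \<and>
      w s < w r \<and> w r < w q \<and> T = {q, r, s}"
    then obtain q r s where qrs: "1 \<le> q" "q < r" "r < s" "s \<le> n" "w s < w r" "w r < w q"
      "T = {q, r, s}" by blast
    define i :: "nat \<Rightarrow> nat" where "i = (\<lambda>j. if j = 1 then q else if j = 2 then r else s)"
    have i: "i 1 = q" "i 2 = r" "i 3 = s" by (simp_all add: i_def)
    have "T = i ` {1..3}" "i ` {1..3} \<subseteq> {1..n}" using qrs unfolding three by (auto simp: i_def)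
    moreover have "strict_mono_on {1..3} i"
      using qrs unfolding three strict_mono_on_def by (auto simp: i_def)
    moreover have "\<forall>h\<in>{1..3}. \<forall>j\<in>{1..3}. w (i h) < w (i j) \<longleftrightarrow> perm321 h < perm321 j"
      unfolding three using qrs by (simp add: i p del: One_nat_def)
    ultimately show "T \<in> patterns321 n w" unfolding patterns321_def patterns_def by blast
  }
qed

text \<open>Read in increasing order, the positions carry the entries z, y, x, so the set of
  positions determines the triple.\<close>

lemma bij_betw_positions:
  assumes w: "w permutes {1..n}"
  shows "bij_betw (positions w) (triples321 w) (patterns321 n w)"
proof (rule bij_betwI')
  have wi: "w (inv w x) = x" "inv w (w x) = x" for x using permutes_inverses[OF w] by simp_all
  {
    fix s t assume s: "s \<in> triples321 w" and t: "t \<in> triples321 w"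
    obtain x y z where s': "s = (x, y, z)" by (cases s)
    obtain a b c where t': "t = (a, b, c)" by (cases t)
    have lt: "inv w z < inv w y" "inv w y < inv w x" "inv w c < inv w b" "inv w b < inv w a"
      using s t by (auto simp: triples321_def s' t')
    show "positions w s = positions w t \<longleftrightarrow> s = t"
    proof
      assume "positions w s = positions w t"
      then have "set [inv w z, inv w y, inv w x] = set [inv w c, inv w b, inv w a]"
        by (simp add: positions_def s' t')
      then have "[inv w z, inv w y, inv w x] = [inv w c, inv w b, inv w a]"
        by (intro sorted_distinct_set_unique) (use lt in auto)
      then show "s = t" unfolding s' t' using wi(1) by (metis list.inject)
    qed simp
  next
    fix t assume "t \<in> triples321 w"
    then obtain x y z where t: "t = (x, y, z)" "x < y" "y < z"
      "inv w z < inv w y" "inv w y < inv w x" by (auto simp: triples321_def)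
    \<comment> \<open>An entry above n is fixed, so no smaller entry stands to its right.\<close>
    have "z \<in> {1..n}"
    proof (rule ccontr)
      assume "z \<notin> {1..n}"
      then have "inv w z = z" using permutes_not_in[OF permutes_inv[OF w]] by blast
      moreover have "inv w y \<le> n \<or> inv w y = y"
        using permutes_not_in[OF permutes_inv[OF w], of y]
          permutes_in_image[OF permutes_inv[OF w], of y] by auto
      ultimately show False using t \<open>z \<notin> {1..n}\<close> by auto
    qed
    then have "1 \<le> inv w z" using permutes_in_image[OF permutes_inv[OF w], of z] by simp
    \<comment> \<open>The only remaining value is 0, which stands at position 0 and has nothing to
      its left.\<close>
    moreover have "x \<in> {1..n}"
    proof (rule ccontr)
      assume "x \<notin> {1..n}"
      moreover have "x \<le> n" using t(2,3) \<open>z \<in> {1..n}\<close> by simp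
      ultimately have "x = 0" by simp
      then have "inv w x = 0" using permutes_not_in[OF permutes_inv[OF w], of 0] by simp
      then show False using t(5) by simp
    qed
    then have "inv w x \<le> n" using permutes_in_image[OF permutes_inv[OF w], of x] by simp
    ultimately show "positions w t \<in> patterns321 n w"
      unfolding mem_patterns321 positions_def t(1) prod.case using t(2-5) wi(1) by metis
  next
    fix T assume "T \<in> patterns321 n w"
    then obtain q r s where "q < r" "r < s" "w s < w r" "w r < w q" "T = {q, r, s}"
      unfolding mem_patterns321 by blast
    then have "(w s, w r, w q) \<in> triples321 w" "T = positions w (w s, w r, w q)"
      by (simp_all add: triples321_def positions_def wi)
    then show "\<exists>t\<in>triples321 w. T = positions w t" by blast
  }
qed

section \<open>Ranks of commutation classes\<close>

text \<open>All terms except the number of triples depend only on \<open>w\<close> and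
  \<open>n\<close>, so the rank is that number up to a constant.\<close>

lemma sum_list_reduced_decomp:
  assumes "\<rho> \<in> reduced_decomps n w"
  shows "sum_list \<rho> + dominated_pairs n w =
    card (inversions n w) + dominated_pairs n id + card (triples id \<rho>)"
proof -
  have asc: "ascending n id \<rho>" "word_perm \<rho> = w" using assms by (simp_all add: mem_reduced_decomps)
  have "length \<rho> = card (inversions n w)" using assms by (simp add: reduced_decomps_def)
  with sum_list_ascending[OF bij_id _ asc(1)] show ?thesis unfolding asc(2) id_comp by simp
qed

lemma class_of_reduced_decomp:
  assumes "\<rho> \<in> reduced_decomps n w"
  shows "\<exists>Y \<in> commutation_classes n w. \<rho> \<in> Y \<and> class_rank Y = sum_list \<rho>"
proof -
  let ?Y = "commutation_equiv n w `` {\<rho>}"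
  have "?Y \<in> commutation_classes n w" unfolding commutation_classes_def using assms by (rule quotientI)
  moreover have "\<rho> \<in> ?Y" using assms by (rule equiv_class_self[OF equiv_commutation_equiv])
  ultimately show ?thesis using class_rank_eq by blast
qed

lemma commutation_class_members:
  assumes "Y \<in> commutation_classes n w"
  shows "Y \<noteq> {}" "Y \<subseteq> reduced_decomps n w"
  using assms in_quotient_imp_non_empty[OF equiv_commutation_equiv]
    in_quotient_imp_subset[OF equiv_commutation_equiv]
  unfolding commutation_classes_def by blast+

text \<open>A triple-free decomposition attains the least sum that the formula allows, which makes
  the lowest rank explicit.\<close>

lemma min_rank_class:
  assumes "w permutes {1..n}"
    and Z: "is_arg_min class_rank (\<lambda>Y. Y \<in> commutation_classes n w) Z"
  shows "class_rank Z + dominated_pairs n w = card (inversions n w) + dominated_pairs n id"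
proof -
  from Z have ZC: "Z \<in> commutation_classes n w"
    and min: "\<And>Y. Y \<in> commutation_classes n w \<Longrightarrow> \<not> class_rank Y < class_rank Z"
    by (auto simp: is_arg_min_def)
  obtain \<tau> where "ascending n id \<tau>" "word_perm \<tau> = w" and empty: "triples id \<tau> = {}"
    using exists_reduced_word_no_triples[OF assms(1)] by blast
  then have \<tau>: "\<tau> \<in> reduced_decomps n w" by (simp add: mem_reduced_decomps)
  obtain Y where "Y \<in> commutation_classes n w" "class_rank Y = sum_list \<tau>"
    using class_of_reduced_decomp[OF \<tau>] by blast
  with min have "class_rank Z \<le> sum_list \<tau>" by (metis not_le)
  moreover obtain \<sigma> where "\<sigma> \<in> Z" using commutation_class_members(1)[OF ZC] by blast
  moreover have "\<sigma> \<in> reduced_decomps n w"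
    using \<open>\<sigma> \<in> Z\<close> commutation_class_members(2)[OF ZC] by blast
  ultimately show ?thesis
    using sum_list_reduced_decomp[of \<sigma> n w] sum_list_reduced_decomp[OF \<tau>] empty class_rank_eq[OF ZC, of \<sigma>]
    by simp
qed

lemma triples_reduced_decomp:
  assumes "\<sigma> \<in> reduced_decomps n w"
  shows "triples id \<sigma> \<subseteq> triples321 w"
proof -
  have asc: "ascending n id \<sigma>" "word_perm \<sigma> = w" using assms by (simp_all add: mem_reduced_decomps)
  show ?thesis using triples_subset_triples321[OF bij_id asc(1)] unfolding asc(2) id_comp .
qed

text \<open>A decomposition of \<open>p\<close> has triple set {} or {t}. The second one occurs and
  has the larger sum, and all decompositions having it form one class by
  \<open>commutation_if_triples_eq\<close>.\<close>

lemma max_rank_class: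
  assumes "p permutes {1..m}" "triples321 p = {t}"
    and X: "is_arg_max class_rank (\<lambda>Y. Y \<in> commutation_classes m p) X"
  shows "X = {\<sigma> \<in> reduced_decomps m p. triples id \<sigma> \<noteq> {}}"
proof -
  from X have XC: "X \<in> commutation_classes m p"
    and max: "\<And>Y. Y \<in> commutation_classes m p \<Longrightarrow> \<not> class_rank X < class_rank Y"
    by (auto simp: is_arg_max_def)
  note members = commutation_class_members[OF XC]
  obtain \<tau> where "ascending m id \<tau>" "word_perm \<tau> = p" and full: "{t} \<subseteq> triples id \<tau>"
    using exists_reduced_word_all_triples[OF assms(1)] unfolding assms(2) by blast
  then have \<tau>: "\<tau> \<in> reduced_decomps m p" by (simp add: mem_reduced_decomps)
  then have tau_t: "triples id \<tau> = {t}" using full triples_reduced_decomp[OF \<tau>] unfolding assms(2) by blast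
  have sub: "triples id \<sigma> \<noteq> {}" if "\<sigma> \<in> X" for \<sigma>
  proof -
    obtain Y where "Y \<in> commutation_classes m p" "class_rank Y = sum_list \<tau>"
      using class_of_reduced_decomp[OF \<tau>] by blast
    with max have "sum_list \<tau> \<le> class_rank X" by (metis not_le)
    moreover have "class_rank X = sum_list \<sigma>" using class_rank_eq[OF XC that] .
    moreover have "\<sigma> \<in> reduced_decomps m p" using that members(2) by blast
    ultimately have "card (triples id \<tau>) \<le> card (triples id \<sigma>)"
      using sum_list_reduced_decomp[of \<sigma> m p] sum_list_reduced_decomp[OF \<tau>] by simp
    then show ?thesis unfolding tau_t by auto
  qed
  have "\<sigma> \<in> X" if \<sigma>: "\<sigma> \<in> reduced_decomps m p" "triples id \<sigma> \<noteq> {}" for \<sigma>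
  proof -
    obtain \<sigma>' where \<sigma>': "\<sigma>' \<in> X" using members(1) by blast
    then have r: "\<sigma>' \<in> reduced_decomps m p" using members(2) by blast
    have "triples id \<sigma>' = triples id \<sigma>"
      using triples_reduced_decomp[OF r] triples_reduced_decomp[OF \<sigma>(1)] sub[OF \<sigma>'] \<sigma>(2)
      unfolding assms(2) by blast
    moreover have "ascending m id \<sigma>'" "ascending m id \<sigma>" "word_perm \<sigma>' = word_perm \<sigma>"
      using r \<sigma>(1) unfolding mem_reduced_decomps by metis+
    ultimately have "commutation_move\<^sup>*\<^sup>* \<sigma>' \<sigma>" by (intro commutation_if_triples_eq[OF bij_id])
    then have "(\<sigma>', \<sigma>) \<in> commutation_equiv m p" using r \<sigma>(1) by (simp add: commutation_equiv_def)
    then show "\<sigma> \<in> X"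
      using in_quotient_imp_closed[OF equiv_commutation_equiv XC[unfolded commutation_classes_def] \<sigma>'] by blast
  qed
  with sub members(2) show ?thesis by blast
qed

section \<open>Counting subnetworks through patterns\<close>

text \<open>Taking values turns a pattern Q into a set A. The induced word of A multiplies out to
  the standardization of A in \<open>w\<close>, and A comes from a p-pattern exactly when this is
  \<open>p\<close>.\<close>

lemma image_patterns_eq_induced:
  assumes w: "w permutes {1..n}" and p: "p permutes {1..m}" and \<rho>: "ascending n id \<rho>" "word_perm \<rho> = w"
    and T: "T \<subseteq> {1..n}"
  shows "(\<lambda>Q. w ` Q) ` {Q \<in> patterns m p n w. T \<subseteq> Q} =
    {A. A \<subseteq> {1..n} \<and> card A = m \<and> word_perm (induced A \<rho>) = p \<and> w ` T \<subseteq> A}"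
proof (intro equalityI subsetI)
  have wi: "w (inv w x) = x" "inv w (w x) = x" for x using permutes_inverses[OF w] by simp_all
  have inj: "inj w" using w by (rule permutes_inj)
  {
    fix A assume "A \<in> (\<lambda>Q. w ` Q) ` {Q \<in> patterns m p n w. T \<subseteq> Q}"
    then obtain i where i: "A = w ` i ` {1..m}" "T \<subseteq> i ` {1..m}" "i ` {1..m} \<subseteq> {1..n}"
      "strict_mono_on {1..m} i"
      "\<And>h j. h \<in> {1..m} \<Longrightarrow> j \<in> {1..m} \<Longrightarrow> w (i h) < w (i j) \<longleftrightarrow> p h < p j"
      unfolding patterns_def by blast
    have "card (i ` {1..m}) = m"
      using card_image[OF strict_mono_on_imp_inj_on[OF i(4)]] by simp
    then have A: "A \<subseteq> {1..n}" "card A = m"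
      using i(3) permutes_image[OF w] card_image[OF inj_on_subset[OF inj subset_UNIV]]
      unfolding i(1) by auto
    obtain e f where e: "strict_mono_on {1..m} e"
      and st: "standardizes m A e f (word_perm \<rho>) (word_perm (induced A \<rho>))"
      by (rule induced_simulation[OF \<rho>(1) A])
    let ?v = "word_perm (induced A \<rho>)"
    have v: "?v permutes {1..m}" "strict_mono_on {1..m} f" "f ` {1..m} = {q. w q \<in> A}"
      "\<And>j. j \<in> {1..m} \<Longrightarrow> w (f j) = e (?v j)"
      using st unfolding \<rho>(2) standardizes_def by blast+
    \<comment> \<open>Both \<open>f\<close> and \<open>i\<close> list the positions of A in
      increasing order, so they agree.\<close>
    have "f ` {1..m} = i ` {1..m}" unfolding v(3) i(1) using inj_image_mem_iff[OF inj] by blast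
    then have fi: "f j = i j" if "j \<in> {1..m}" for j
      by (rule strict_mono_on_image_eq[OF v(2) i(4) _ that])
    have "?v = p"
    proof (rule permutes_eq_if_order_iso[OF v(1) p])
      fix h j assume hj: "h \<in> {1..m}" "j \<in> {1..m}"
      have "?v h \<in> {1..m}" "?v j \<in> {1..m}" using permutes_in_image[OF v(1)] hj by blast+
      then have "?v h < ?v j \<longleftrightarrow> e (?v h) < e (?v j)" using strict_mono_on_less[OF e] by blast
      also have "\<dots> \<longleftrightarrow> w (i h) < w (i j)" unfolding v(4)[OF hj(1), symmetric] v(4)[OF hj(2), symmetric]
        fi[OF hj(1)] fi[OF hj(2)] ..
      also have "\<dots> \<longleftrightarrow> p h < p j" using i(5)[OF hj] .
      finally show "?v h < ?v j \<longleftrightarrow> p h < p j" .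
    qed
    with A i(1,2) show "A \<in> {A. A \<subseteq> {1..n} \<and> card A = m \<and> word_perm (induced A \<rho>) = p \<and> w ` T \<subseteq> A}"
      by blast
  next
    fix A assume "A \<in> {A. A \<subseteq> {1..n} \<and> card A = m \<and> word_perm (induced A \<rho>) = p \<and> w ` T \<subseteq> A}"
    then have A: "A \<subseteq> {1..n}" "card A = m" "word_perm (induced A \<rho>) = p" "w ` T \<subseteq> A" by blast+
    obtain e f where e: "strict_mono_on {1..m} e"
      and st: "standardizes m A e f (word_perm \<rho>) (word_perm (induced A \<rho>))"
      by (rule induced_simulation[OF \<rho>(1) A(1,2)])
    have f: "strict_mono_on {1..m} f" "f ` {1..m} = {q. w q \<in> A}"
      "\<And>j. j \<in> {1..m} \<Longrightarrow> w (f j) = e (p j)"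
      using st unfolding \<rho>(2) A(3) standardizes_def by blast+
    have "f ` {1..m} \<subseteq> {1..n}" unfolding f(2) using A(1) permutes_in_image[OF w] by blast
    moreover have "w (f h) < w (f j) \<longleftrightarrow> p h < p j" if "h \<in> {1..m}" "j \<in> {1..m}" for h j
      unfolding f(3)[OF that(1)] f(3)[OF that(2)]
      by (rule strict_mono_on_less[OF e]) (use permutes_in_image[OF p] that in blast)+
    ultimately have "f ` {1..m} \<in> patterns m p n w" using f(1) unfolding patterns_def by blast
    moreover have "T \<subseteq> f ` {1..m}" unfolding f(2) using A(4) by blast
    moreover have "A = w ` f ` {1..m}" unfolding f(2)
    proof (intro equalityI subsetI)
      fix x assume "x \<in> A"
      then have "w (inv w x) \<in> A" by (simp add: wi)
      then have "w (inv w x) \<in> w ` {q. w q \<in> A}" by blast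
      then show "x \<in> w ` {q. w q \<in> A}" unfolding wi .
    qed blast
    ultimately show "A \<in> (\<lambda>Q. w ` Q) ` {Q \<in> patterns m p n w. T \<subseteq> Q}" by blast
  }
qed

theorem proposition5p2:
  fixes m n k c :: nat
    and p w :: "nat \<Rightarrow> nat"
    and X Z :: "nat list set"
    and \<rho> :: "nat list"
  assumes "p permutes {1..m}"
    and "card (patterns321 m p) = 1"
    and "w permutes {1..n}"
    and "friendly m p n w"
    and "friendly_with m p n w k"
    and "is_arg_max class_rank (\<lambda>Y. Y \<in> carrier (class_poset m p)) X"
    and "is_arg_min class_rank (\<lambda>Y. Y \<in> carrier (class_poset n w)) Z"
    and "c = class_rank Z"
    and "\<rho> \<in> reduced_decomps n w"
  shows "int (card (subnetworks m X n \<rho>)) = int k * (int (sum_list \<rho>) - int c)"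
proof -
  have carrier: "carrier (class_poset l u) = commutation_classes l u" for l u
    by (simp add: class_poset_def)
  have \<rho>: "ascending n id \<rho>" "word_perm \<rho> = w" using assms(9) by (simp_all add: mem_reduced_decomps)
  have "card (triples321 p) = 1"
    using bij_betw_same_card[OF bij_betw_positions[OF assms(1)]] assms(2) by simp
  then obtain t0 where t0: "triples321 p = {t0}" by (rule card_1_singletonE)
  note X = max_rank_class[OF assms(1) t0 assms(6)[unfolded carrier]]
  define M where "M = triples id \<rho>"
  \<comment> \<open>\<open>B t\<close> consists of the value sets of the p-patterns containing t, so
    friendliness gives its size.\<close>
  define B where "B = (\<lambda>(x, y, z). {A. A \<subseteq> {1..n} \<and> card A = m \<and>
    word_perm (induced A \<rho>) = p \<and> {z, y, x} \<subseteq> A})"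
  have M321: "M \<subseteq> triples321 w" unfolding M_def by (rule triples_reduced_decomp[OF assms(9)])
  have fin: "finite (B t)" for t
    by (rule finite_subset[of _ "Pow {1..n}"]) (auto simp: B_def split: prod.splits)
  have card_B: "card (B t) = k" if "t \<in> M" for t
  proof -
    obtain x y z where t: "t = (x, y, z)" by (cases t)
    have T: "positions w t \<in> patterns321 n w"
      using bij_betw_positions[OF assms(3)] that M321 by (auto dest: bij_betwE)
    then have "positions w t \<subseteq> {1..n}" unfolding mem_patterns321 by auto
    moreover have "w ` positions w t = {z, y, x}"
      using permutes_inverses[OF assms(3)] by (simp add: positions_def t)
    ultimately have "B t = (\<lambda>Q. w ` Q) ` {Q \<in> patterns m p n w. positions w t \<subseteq> Q}"
      using image_patterns_eq_induced[OF assms(3,1) \<rho>] by (simp add: B_def t)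
    moreover have "inj_on (\<lambda>Q. w ` Q) S" for S
      using permutes_inj[OF assms(3)] by (intro inj_onI) (simp add: inj_image_eq_iff)
    ultimately have "card (B t) = card {Q \<in> patterns m p n w. positions w t \<subseteq> Q}"
      by (simp add: card_image)
    then show ?thesis using assms(5) T by (simp add: friendly_with_def)
  qed
  have A_triples: "induced A \<rho> \<in> reduced_decomps m p \<and>
      (\<exists>e. M \<inter> A \<times> A \<times> A = map_triple e ` triples id (induced A \<rho>))"
    if "A \<subseteq> {1..n}" "card A = m" "word_perm (induced A \<rho>) = p" for A
    using induced_simulation[OF \<rho>(1) that(1,2)] that(3) unfolding mem_reduced_decomps M_def by metis
  \<comment> \<open>An induced decomposition of \<open>p\<close> lies in \<open>X\<close> exactly
    when it has a triple, that is, when A contains a triple of \<open>\<rho>\<close>.\<close>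
  have "subnetworks m X n \<rho> = (\<Union>t\<in>M. B t)"
  proof (intro equalityI subsetI)
    fix A assume "A \<in> subnetworks m X n \<rho>"
    then have A: "A \<subseteq> {1..n}" "card A = m" "induced A \<rho> \<in> reduced_decomps m p"
      "triples id (induced A \<rho>) \<noteq> {}" unfolding X subnetworks_def by blast+
    have wp: "word_perm (induced A \<rho>) = p" using A(3) unfolding mem_reduced_decomps by blast
    then have "M \<inter> A \<times> A \<times> A \<noteq> {}" using A_triples[OF A(1,2)] A(4) by auto
    then obtain x y z where "(x, y, z) \<in> M" "{z, y, x} \<subseteq> A" by auto
    with A(1,2) wp show "A \<in> (\<Union>t\<in>M. B t)" by (intro UN_I[of "(x, y, z)"]) (auto simp: B_def)
  next
    fix A assume "A \<in> (\<Union>t\<in>M. B t)"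
    then obtain x y z where A: "(x, y, z) \<in> M" "A \<subseteq> {1..n}" "card A = m"
      "word_perm (induced A \<rho>) = p" "{z, y, x} \<subseteq> A" by (auto simp: B_def)
    then have "M \<inter> A \<times> A \<times> A \<noteq> {}" by blast
    with A_triples[OF A(2-4)] A(2,3) show "A \<in> subnetworks m X n \<rho>"
      unfolding X subnetworks_def by auto
  qed
  moreover have "card (\<Union>t\<in>M. B t) = (\<Sum>t\<in>M. card (B t))"
  proof (rule card_UN_disjoint)
    show "finite M" unfolding M_def by (rule finite_triples[OF bij_id])
    show "\<forall>t\<in>M. finite (B t)" using fin by blast
    \<comment> \<open>As \<open>p\<close> has just one 321-pattern, a set A inducing a decomposition
      of \<open>p\<close> contains at most one triple of \<open>\<rho>\<close>.\<close>
    have False if st: "s \<in> M" "t \<in> M" "s \<noteq> t" "A \<in> B s" "A \<in> B t" for s t A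
    proof -
      have A: "A \<subseteq> {1..n}" "card A = m" "word_perm (induced A \<rho>) = p" and mem: "s \<in> A \<times> A \<times> A" "t \<in> A \<times> A \<times> A"
        using st(4,5) by (auto simp: B_def split: prod.splits)
      obtain e where "M \<inter> A \<times> A \<times> A = map_triple e ` triples id (induced A \<rho>)"
        and "triples id (induced A \<rho>) \<subseteq> {t0}"
        using A_triples[OF A] triples_reduced_decomp[of "induced A \<rho>" m p] unfolding t0 by blast
      then have "M \<inter> A \<times> A \<times> A \<subseteq> {map_triple e t0}" by auto
      moreover have "s \<in> M \<inter> A \<times> A \<times> A" "t \<in> M \<inter> A \<times> A \<times> A" using st(1,2) mem by simp_all
      ultimately have "s = map_triple e t0" "t = map_triple e t0" by blast+
      with st(3) show False by simp
    qed
    then show "\<forall>s\<in>M. \<forall>t\<in>M. s \<noteq> t \<longrightarrow> B s \<inter> B t = {}" by blast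
  qed
  ultimately have "card (subnetworks m X n \<rho>) = k * card M" using card_B by simp
  \<comment> \<open>Comparing with the explicit lowest rank leaves just the number of
    triples.\<close>
  moreover have "sum_list \<rho> = c + card M"
    using sum_list_reduced_decomp[OF assms(9)] min_rank_class[OF assms(3) assms(7)[unfolded carrier]]
    unfolding assms(8) M_def by simp
  ultimately show ?thesis by simp
qed

end
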